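(* Let $\Theta\subset\mathbb{R}^m$ and let $\theta\mapsto f_\theta$ be a differentiable map from $\Theta$ to $L^2(\rho_0)$ such that the matrix $G_\theta=\int_{\mathbb{R}^d}(D_\theta f_\theta(x))^\top D_\theta f_\theta(x)\,\mathrm{d}\rho_0(x)\in\mathbb{R}^{m\times m}$ is invertible for all $\theta\in\Theta$. Let $F:\mathcal{P}_2(\mathbb{R}^d)\to\mathbb{R}$ be Wasserstein differentiable, with Wasserstein gradient $\nabla_{\mathrm{W}}F$. Assume that the drift field is $V_\theta:=-\nabla_{\mathrm{W}}F((f_\theta)_*\rho_0)$. Then the Gauss--Newton scheme on the drifting loss $\mathcal{L}_{\mathrm{drift}}$, namely $$\theta_{k+1}=\theta_k+\tau\,\delta\theta_k,\qquad \delta\theta_k\in\operatorname*{arg\,min}_{\delta\theta\in\mathbb{R}^m}\big\|-V_{\theta_k}\circ f_{\theta_k}+D_\theta f_{\theta_k}.\delta\theta\big\|_{\rho_0}^2,$$ with step size $\tau>0$, is the $L^2(\rho_0)$-natural gradient descent (with the same step size $\tau$) on $\Theta$ of the loss $\mathcal{L}_D:\theta\mapsto F((f_\theta)_*\rho_0)$.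
   Context: $\mathcal{P}_2(\mathbb{R}^d)$ is the set of probability measures on $\mathbb{R}^d$ with finite second-order moment, and $\rho_0\in\mathcal{P}_2(\mathbb{R}^d)$ is a fixed absolutely continuous probability measure. $L^2(\rho_0)$ is the Hilbert space of measurable maps $f:\mathbb{R}^d\to\mathbb{R}^d$ that are square-integrable with respect to $\rho_0$, with norm $\|\cdot\|_{\rho_0}$ and scalar product $\langle\cdot,\cdot\rangle_{\rho_0}$. The pushforward of $\rho$ by a measurable map $f$ is $f_*\rho(A)=\rho(f^{-1}(A))$. Wasserstein gradient: the Wasserstein gradient $\nabla_{\mathrm{W}}F(\rho)$ of $F:\mathcal{P}_2(\mathbb{R}^d)\to\mathbb{R}$ at $\rho$, if it exists, is the vector field defined by $F((\mathrm{id}+h)_*\rho)=F(\rho)+\int_{\mathbb{R}^d}\langle\nabla_{\mathrm{W}}F(\rho),h\rangle\,\mathrm{d}\rho+o(h)$. $F$ is Wasserstein differentiable if it exists at every $\rho$. Drifting loss: given vector fields $V_\theta:\mathbb{R}^d\to\mathbb{R}^d$, $\mathcal{L}_{\mathrm{drift}}(\theta)=\frac12\|f_\theta-\mathtt{sg}(f_\theta+V_\theta\circ f_\theta)\|_{\rho_0}^2$, where $\mathtt{sg}$ is the stop-gradient operator: its argument is evaluated at the current $\theta$ and treated as a constant when differentiating with respect to $\theta$. The Gauss--Newton scheme for a loss $\frac12\|\ell(\theta)\|^2$ is $\theta_{k+1}=\theta_k+\tau\delta\theta_k$ with $\delta\theta_k\in\operatorname{arg\,min}_{\delta\theta}\|\ell(\theta_k)+D_\theta\ell(\theta_k)\delta\theta\|^2$;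 for $\mathcal{L}_{\mathrm{drift}}$ this gives the scheme written in the claim. $D_\theta f_\theta(x)\in\mathbb{R}^{d\times m}$ denotes the Jacobian of $\theta\mapsto f_\theta(x)$, and $D_\theta f_\theta.\delta\theta\in L^2(\rho_0)$ is the differential of $\theta\mapsto f_\theta$ applied to $\delta\theta$. Pullback metric: for a differentiable map $\phi:\Theta\to M$, $\theta\mapsto f_\theta$, with injective differential, into a Riemannian manifold $(M,g)$ (possibly infinite-dimensional), the pullback metric is $(\phi^*g)_\theta(\delta\theta,\delta\theta)=g_{f_\theta}(d_\theta\phi[\delta\theta],d_\theta\phi[\delta\theta])$. $L^2(\rho_0)$-natural gradient descent: for $\theta\mapsto f_\theta$ differentiable from $\Theta$ to $L^2(\rho_0)$ with injective differential at all $\theta$, and $f\mapsto F(f_*\rho_0)$ differentiable from $L^2(\rho_0)$ to $\mathbb{R}$, the $L^2(\rho_0)$-natural gradient descent of $\theta\mapsto F((f_\theta)_*\rho_0)$ on $\Theta$ is its (explicit, step size $\tau$) gradient descent with respect to the pullback by $\theta\mapsto f_\theta$ of the flat $L^2(\rho_0)$-metric, i.e. $\theta_{k+1}=\theta_k-\tau\,\mathrm{grad}\,\mathcal{L}_D(\theta_k)$, where $\mathrm{grad}$ is the Riemannian gradient for that pullback metric on $\Theta$. *)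

theory Defs
  imports "HOL-Probability.Probability"
begin

definition P2 :: "(real^'d) measure set" where
  "P2 = {\<rho>. prob_space \<rho> \<and> sets \<rho> = sets borel \<and> integrable \<rho> (\<lambda>x. (norm x)\<^sup>2)}"

abbreviation pushforward :: "(real^'d \<Rightarrow> real^'d) \<Rightarrow> (real^'d) measure \<Rightarrow> (real^'d) measure" where
  "pushforward f \<rho> \<equiv> distr \<rho> borel f"

text \<open>Elements of $L^2(\rho)$ are represented by functions rather than by classes modulo
  $\rho$-almost everywhere equality; accordingly \<open>l2_norm\<close> is only a seminorm on
  \<open>L2 \<rho>\<close>, and linearity and injectivity of \<open>L2\<close>-valued maps below are meant
  up to $\rho$-null sets.\<close>

definition L2 :: "(real^'d) measure \<Rightarrow> (real^'d \<Rightarrow> real^'d) set" where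
  "L2 \<rho> = {f. f \<in> borel_measurable \<rho> \<and> integrable \<rho> (\<lambda>x. (norm (f x))\<^sup>2)}"

definition l2_inner ::
  "(real^'d) measure \<Rightarrow> (real^'d \<Rightarrow> real^'d) \<Rightarrow> (real^'d \<Rightarrow> real^'d) \<Rightarrow> real" where
  "l2_inner \<rho> f g = (LINT x|\<rho>. f x \<bullet> g x)"

definition l2_norm :: "(real^'d) measure \<Rightarrow> (real^'d \<Rightarrow> real^'d) \<Rightarrow> real" where
  "l2_norm \<rho> f = sqrt (l2_inner \<rho> f f)"

text \<open>Frechet differentiability at \<open>\<theta>\<close> of a map \<open>\<phi>\<close> from $\mathbb{R}^m$ to
  $L^2(\rho)$, with differential \<open>D\<close>. Only the values of \<open>\<phi>\<close> near \<open>\<theta>\<close> matter, so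
  on an open parameter set this is differentiability of the restriction to that set.
  Boundedness of \<open>D\<close> is automatic, its domain being finite-dimensional. Every
  differential is represented by a field of $d \times m$ matrices \<open>J x\<close> via
  \<open>D h x = J x *v h\<close>; when the pointwise Jacobian of $\theta \mapsto \phi_\theta(x)$
  exists for almost every \<open>x\<close>, it agrees with \<open>J x\<close> almost everywhere.\<close>

definition has_l2_derivative ::
  "(real^'d) measure \<Rightarrow> (real^'m \<Rightarrow> real^'d \<Rightarrow> real^'d) \<Rightarrow> (real^'m \<Rightarrow> real^'d \<Rightarrow> real^'d)
    \<Rightarrow> real^'m \<Rightarrow> bool" where
  "has_l2_derivative \<rho> \<phi> D \<theta> \<longleftrightarrow>
     (\<forall>\<^sub>F \<eta> in nhds \<theta>. \<phi> \<eta> \<in> L2 \<rho>) \<and>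
     (\<forall>h. D h \<in> L2 \<rho>) \<and>
     (\<forall>a b h k. AE x in \<rho>. D (a *\<^sub>R h + b *\<^sub>R k) x = a *\<^sub>R D h x + b *\<^sub>R D k x) \<and>
     ((\<lambda>\<eta>. l2_norm \<rho> (\<lambda>x. \<phi> \<eta> x - \<phi> \<theta> x - D (\<eta> - \<theta>) x) / norm (\<eta> - \<theta>)) \<longlongrightarrow> 0) (at \<theta>)"

definition l2_injective ::
  "(real^'d) measure \<Rightarrow> (real^'m \<Rightarrow> real^'d \<Rightarrow> real^'d) \<Rightarrow> bool" where
  "l2_injective \<rho> D \<longleftrightarrow> (\<forall>h k. (AE x in \<rho>. D h x = D k x) \<longrightarrow> h = k)"

text \<open>Frechet differentiability at \<open>f\<close> of a functional \<open>\<Phi>\<close> from $L^2(\rho)$ to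
  $\mathbb{R}$; \<open>A\<close> is the bounded linear differential.\<close>

definition l2_functional_differentiable ::
  "(real^'d) measure \<Rightarrow> ((real^'d \<Rightarrow> real^'d) \<Rightarrow> real) \<Rightarrow> (real^'d \<Rightarrow> real^'d) \<Rightarrow> bool" where
  "l2_functional_differentiable \<rho> \<Phi> f \<longleftrightarrow>
     (\<exists>A. (\<forall>a b. \<forall>g\<in>L2 \<rho>. \<forall>h\<in>L2 \<rho>. A (\<lambda>x. a *\<^sub>R g x + b *\<^sub>R h x) = a * A g + b * A h) \<and>
          (\<exists>C. \<forall>g\<in>L2 \<rho>. \<bar>A g\<bar> \<le> C * l2_norm \<rho> g) \<and>
          (\<forall>\<epsilon>>0. \<exists>\<delta>>0. \<forall>g\<in>L2 \<rho>. l2_norm \<rho> g < \<delta> \<longrightarrow>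
              \<bar>\<Phi> (\<lambda>x. f x + g x) - \<Phi> f - A g\<bar> \<le> \<epsilon> * l2_norm \<rho> g))"

text \<open>The perturbations \<open>h\<close> range over $L^2(\rho)$ and $o(h)$ refers to the norm of
  $L^2(\rho)$. The gradient is required to lie in $L^2(\rho)$, so that its scalar product
  with every such \<open>h\<close> is a genuine integral; it is determined up to $\rho$-null sets.\<close>

definition has_wasserstein_gradient ::
  "((real^'d) measure \<Rightarrow> real) \<Rightarrow> (real^'d \<Rightarrow> real^'d) \<Rightarrow> (real^'d) measure \<Rightarrow> bool" where
  "has_wasserstein_gradient F v \<rho> \<longleftrightarrow>
     v \<in> L2 \<rho> \<and>
     (\<forall>\<epsilon>>0. \<exists>\<delta>>0. \<forall>h\<in>L2 \<rho>. l2_norm \<rho> h < \<delta> \<longrightarrow>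
        \<bar>F (pushforward (\<lambda>x. x + h x) \<rho>) - F \<rho> - l2_inner \<rho> v h\<bar> \<le> \<epsilon> * l2_norm \<rho> h)"

text \<open>One Gauss--Newton step from \<open>\<theta>\<close> for the loss
  $\frac12 \| \ell(\cdot) \|_\rho^2$. The set is independent of the choice of \<open>D\<close>, which is
  unique up to $\rho$-null sets.\<close>

definition gauss_newton_update ::
  "(real^'d) measure \<Rightarrow> (real^'m \<Rightarrow> real^'d \<Rightarrow> real^'d) \<Rightarrow> real \<Rightarrow> real^'m \<Rightarrow> (real^'m) set" where
  "gauss_newton_update \<rho> l \<tau> \<theta> =
     {\<theta> + \<tau> *\<^sub>R \<delta> | \<delta> D. has_l2_derivative \<rho> l D \<theta> \<and>
        is_arg_min (\<lambda>\<delta>. (l2_norm \<rho> (\<lambda>x. l \<theta> x + D \<delta> x))\<^sup>2) (\<lambda>_. True) \<delta>}"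

text \<open>The stop-gradient is encoded by a separate argument: \<open>c\<close> is the parameter at which
  the argument of \<open>sg\<close> is evaluated. It is set to the current parameter, but only the
  dependence on \<open>\<theta>\<close> is differentiated.\<close>

definition drift_residual ::
  "(real^'m \<Rightarrow> real^'d \<Rightarrow> real^'d) \<Rightarrow> (real^'m \<Rightarrow> real^'d \<Rightarrow> real^'d)
    \<Rightarrow> real^'m \<Rightarrow> real^'m \<Rightarrow> real^'d \<Rightarrow> real^'d" where
  "drift_residual f V c \<theta> = (\<lambda>x. f \<theta> x - (f c x + V c (f c x)))"

definition drift_loss ::
  "(real^'d) measure \<Rightarrow> (real^'m \<Rightarrow> real^'d \<Rightarrow> real^'d) \<Rightarrow> (real^'m \<Rightarrow> real^'d \<Rightarrow> real^'d)
    \<Rightarrow> real^'m \<Rightarrow> real" where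
  "drift_loss \<rho> f V \<theta> = 1 / 2 * (l2_norm \<rho> (drift_residual f V \<theta> \<theta>))\<^sup>2"

text \<open>Gauss--Newton on \<open>drift_loss\<close>: the stop-gradient is frozen at the current iterate.\<close>

definition drift_gauss_newton_update ::
  "(real^'d) measure \<Rightarrow> (real^'m \<Rightarrow> real^'d \<Rightarrow> real^'d) \<Rightarrow> (real^'m \<Rightarrow> real^'d \<Rightarrow> real^'d)
    \<Rightarrow> real \<Rightarrow> real^'m \<Rightarrow> (real^'m) set" where
  "drift_gauss_newton_update \<rho> f V \<tau> \<theta> = gauss_newton_update \<rho> (drift_residual f V \<theta>) \<tau> \<theta>"

definition l2_pullback_metric ::
  "(real^'d) measure \<Rightarrow> (real^'m \<Rightarrow> real^'m \<Rightarrow> real^'d \<Rightarrow> real^'d)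
    \<Rightarrow> real^'m \<Rightarrow> real^'m \<Rightarrow> real^'m \<Rightarrow> real" where
  "l2_pullback_metric \<rho> D \<theta> u v = l2_inner \<rho> (D \<theta> u) (D \<theta> v)"

text \<open>\<open>v\<close> is the gradient at \<open>\<theta>\<close> of \<open>L\<close> for the Riemannian metric \<open>g\<close>: the
  differential of \<open>L\<close> exists and is represented by \<open>v\<close> through \<open>g \<theta>\<close>.\<close>

definition has_riemannian_gradient ::
  "(real^'m \<Rightarrow> real^'m \<Rightarrow> real^'m \<Rightarrow> real) \<Rightarrow> (real^'m \<Rightarrow> real) \<Rightarrow> real^'m \<Rightarrow> real^'m \<Rightarrow> bool" where
  "has_riemannian_gradient g L v \<theta> \<longleftrightarrow> (L has_derivative (\<lambda>h. g \<theta> v h)) (at \<theta>)"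

definition riemannian_gradient_update ::
  "(real^'m \<Rightarrow> real^'m \<Rightarrow> real^'m \<Rightarrow> real) \<Rightarrow> (real^'m \<Rightarrow> real) \<Rightarrow> real \<Rightarrow> real^'m
    \<Rightarrow> (real^'m) set" where
  "riemannian_gradient_update g L \<tau> \<theta> = {\<theta> - \<tau> *\<^sub>R v | v. has_riemannian_gradient g L v \<theta>}"

text \<open>\<open>D \<theta>\<close> is the differential at \<open>\<theta>\<close> of \<open>f\<close> as a map into $L^2(\rho)$.\<close>

definition l2_natural_gradient_update ::
  "(real^'d) measure \<Rightarrow> (real^'m \<Rightarrow> real^'d \<Rightarrow> real^'d) \<Rightarrow> (real^'m \<Rightarrow> real^'m \<Rightarrow> real^'d \<Rightarrow> real^'d)
    \<Rightarrow> ((real^'d) measure \<Rightarrow> real) \<Rightarrow> real \<Rightarrow> real^'m \<Rightarrow> (real^'m) set" where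
  "l2_natural_gradient_update \<rho> f D F \<tau> =
     riemannian_gradient_update (l2_pullback_metric \<rho> D) (\<lambda>\<theta>. F (pushforward (f \<theta>) \<rho>)) \<tau>"

text \<open>Iterates are required to stay in the parameter set \<open>\<Theta>\<close>.\<close>

definition is_scheme :: "(real^'m) set \<Rightarrow> (real^'m \<Rightarrow> (real^'m) set) \<Rightarrow> (nat \<Rightarrow> real^'m) \<Rightarrow> bool" where
  "is_scheme \<Theta> U \<theta> \<longleftrightarrow> (\<forall>k. \<theta> k \<in> \<Theta> \<and> \<theta> (Suc k) \<in> U (\<theta> k))"

end

(* Everything rests on one fact: the differential at f of the lifted functional g |-> F(g_* rho) is
   represented by (grad F)(f_* rho) o f against every direction h in L2(rho). The definition of the
   Wasserstein gradient gives this only for directions of the form k o f, which is not enough when f is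
   not injective. The remaining directions are handled by law invariance. Approximate f, and
   (grad F)(f_* rho) o f, by functions constant on finitely many cells measurable with respect to f.
   If S and S' occupy the same proportion of every cell, the approximation of f has the same law after
   perturbation by a small multiple of the indicator of S as after perturbation by that of S', so the
   differential takes nearly the same value on both. As rho has no atoms, one can choose arbitrarily
   many such S' whose deviations from the cell proportions are pairwise orthogonal; since the
   differential is bounded, it nearly vanishes on such a deviation. Hence the indicator of S may be
   replaced by its cell average, which is a function of f.

   Once this is known, both updates are solutions of the normal equations: with G the Gram matrix and
   b . h = <(grad F)(f_* rho) o f, J h>, the Riemannian gradient is the v with G v = b, and the
   minimiser of |(grad F)(f_* rho) o f + J d|^2 is d = -v. *)

theory Submission
  imports Defs "HOL-Real_Asymp.Real_Asymp"
begin

subsection \<open>The space of square integrable vector fields\<close>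

lemma L2_integrable_inner:
  assumes "f \<in> L2 \<rho>" "g \<in> L2 \<rho>"
  shows "integrable \<rho> (\<lambda>x. f x \<bullet> g x)"
proof (rule Bochner_Integration.integrable_bound)
  show "integrable \<rho> (\<lambda>x. (norm (f x))\<^sup>2 + (norm (g x))\<^sup>2)"
    using assms by (auto simp: L2_def)
  show "(\<lambda>x. f x \<bullet> g x) \<in> borel_measurable \<rho>"
    using assms by (auto simp: L2_def)
  have "\<bar>a \<bullet> b\<bar> \<le> (norm a)\<^sup>2 + (norm b)\<^sup>2" for a b :: "real^'a"
  proof -
    have "\<bar>a \<bullet> b\<bar> \<le> norm a * norm b"
      by (rule Cauchy_Schwarz_ineq2)
    moreover have "2 * (norm a * norm b) \<le> (norm a)\<^sup>2 + (norm b)\<^sup>2"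
      using sum_squares_bound[of "norm a" "norm b"] by (simp add: mult.assoc)
    moreover have "0 \<le> norm a * norm b" by simp
    ultimately show ?thesis by linarith
  qed
  then show "AE x in \<rho>. norm (f x \<bullet> g x) \<le> norm ((norm (f x))\<^sup>2 + (norm (g x))\<^sup>2)"
    by simp
qed

lemma L2_measurable: "f \<in> L2 \<rho> \<Longrightarrow> f \<in> borel_measurable \<rho>"
  by (simp add: L2_def)

lemma L2_scaleR: "f \<in> L2 \<rho> \<Longrightarrow> (\<lambda>x. a *\<^sub>R f x) \<in> L2 \<rho>"
  by (auto simp: L2_def power_mult_distrib)

lemma L2_add:
  assumes "f \<in> L2 \<rho>" "g \<in> L2 \<rho>"
  shows "(\<lambda>x. f x + g x) \<in> L2 \<rho>"
proof -
  have "integrable \<rho> (\<lambda>x. f x \<bullet> f x + 2 * (f x \<bullet> g x) + g x \<bullet> g x)"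
    using assms by (intro Bochner_Integration.integrable_add integrable_mult_right L2_integrable_inner)
  moreover have "(norm (f x + g x))\<^sup>2 = f x \<bullet> f x + 2 * (f x \<bullet> g x) + g x \<bullet> g x" for x
    by (simp add: power2_norm_eq_inner inner_add_left inner_add_right inner_commute)
  ultimately show ?thesis
    using assms by (auto simp: L2_def)
qed

lemma L2_minus: "f \<in> L2 \<rho> \<Longrightarrow> (\<lambda>x. - f x) \<in> L2 \<rho>"
  using L2_scaleR[of f \<rho> "-1"] by simp

lemma L2_diff: "f \<in> L2 \<rho> \<Longrightarrow> g \<in> L2 \<rho> \<Longrightarrow> (\<lambda>x. f x - g x) \<in> L2 \<rho>"
  using L2_add[of f \<rho> "\<lambda>x. - g x"] L2_minus[of g \<rho>] by simp

text \<open>Moves square integrability between \<open>\<rho>\<close> and the law of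
  \<open>f\<close>. Measurability of \<open>g\<close> is a separate conjunct because measurability
  of its composition with \<open>f\<close> does not imply it.\<close>

lemma L2_distr:
  assumes "f \<in> borel_measurable \<rho>"
  shows "g \<in> L2 (distr \<rho> borel f) \<longleftrightarrow> g \<in> borel_measurable borel \<and> (\<lambda>x. g (f x)) \<in> L2 \<rho>"
proof (cases "g \<in> borel_measurable borel")
  case True
  then have "(\<lambda>x. (norm (g x))\<^sup>2) \<in> borel_measurable borel"
    by measurable
  moreover have "(\<lambda>x. g (f x)) \<in> borel_measurable \<rho>"
    using assms True by measurable
  ultimately show ?thesis
    using assms True by (simp add: L2_def integrable_distr_eq)
qed (auto simp: L2_def)

lemma l2_inner_commute: "l2_inner \<rho> f g = l2_inner \<rho> g f"
  by (simp add: l2_inner_def inner_commute)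

lemma l2_inner_add_left:
  assumes "f \<in> L2 \<rho>" "g \<in> L2 \<rho>" "h \<in> L2 \<rho>"
  shows "l2_inner \<rho> (\<lambda>x. f x + g x) h = l2_inner \<rho> f h + l2_inner \<rho> g h"
  using assms by (simp add: l2_inner_def inner_add_left L2_integrable_inner)

lemma l2_inner_diff_left:
  assumes "f \<in> L2 \<rho>" "g \<in> L2 \<rho>" "h \<in> L2 \<rho>"
  shows "l2_inner \<rho> (\<lambda>x. f x - g x) h = l2_inner \<rho> f h - l2_inner \<rho> g h"
  using assms by (simp add: l2_inner_def inner_diff_left L2_integrable_inner)

lemma l2_inner_scaleR_left: "l2_inner \<rho> (\<lambda>x. a *\<^sub>R f x) h = a * l2_inner \<rho> f h"
  by (simp add: l2_inner_def)

lemma l2_inner_add_right: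
  assumes "f \<in> L2 \<rho>" "g \<in> L2 \<rho>" "h \<in> L2 \<rho>"
  shows "l2_inner \<rho> h (\<lambda>x. f x + g x) = l2_inner \<rho> h f + l2_inner \<rho> h g"
  using assms by (simp add: l2_inner_def inner_add_right L2_integrable_inner)

lemma l2_inner_diff_right:
  assumes "f \<in> L2 \<rho>" "g \<in> L2 \<rho>" "h \<in> L2 \<rho>"
  shows "l2_inner \<rho> h (\<lambda>x. f x - g x) = l2_inner \<rho> h f - l2_inner \<rho> h g"
  using assms by (simp add: l2_inner_def inner_diff_right L2_integrable_inner)

lemma l2_inner_scaleR_right: "l2_inner \<rho> h (\<lambda>x. a *\<^sub>R f x) = a * l2_inner \<rho> h f"
  by (simp add: l2_inner_def)

lemma l2_inner_self_nonneg: "0 \<le> l2_inner \<rho> f f"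
  by (simp add: l2_inner_def)

lemma l2_norm_nonneg: "0 \<le> l2_norm \<rho> f"
  by (simp add: l2_norm_def l2_inner_self_nonneg)

lemma l2_norm_power2: "(l2_norm \<rho> f)\<^sup>2 = l2_inner \<rho> f f"
  by (simp add: l2_norm_def l2_inner_self_nonneg)

lemma l2_norm_scaleR: "l2_norm \<rho> (\<lambda>x. a *\<^sub>R f x) = \<bar>a\<bar> * l2_norm \<rho> f"
  by (simp add: l2_norm_def l2_inner_def real_sqrt_mult flip: power2_eq_square mult.assoc)

lemma l2_norm_minus: "l2_norm \<rho> (\<lambda>x. - f x) = l2_norm \<rho> f"
  by (simp add: l2_norm_def l2_inner_def)

lemma l2_inner_cong_AE:
  assumes "f \<in> L2 \<rho>" "f' \<in> L2 \<rho>" "g \<in> L2 \<rho>" "g' \<in> L2 \<rho>"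
    and "AE x in \<rho>. f x = f' x" "AE x in \<rho>. g x = g' x"
  shows "l2_inner \<rho> f g = l2_inner \<rho> f' g'"
  unfolding l2_inner_def
proof (rule integral_cong_AE)
  show "AE x in \<rho>. f x \<bullet> g x = f' x \<bullet> g' x"
    using assms(5,6) by eventually_elim simp
qed (use assms(1-4) in \<open>auto simp: L2_def\<close>)

lemma l2_norm_cong_AE:
  assumes "f \<in> L2 \<rho>" "g \<in> L2 \<rho>" "AE x in \<rho>. f x = g x"
  shows "l2_norm \<rho> f = l2_norm \<rho> g"
  unfolding l2_norm_def using l2_inner_cong_AE[OF assms(1,2) assms(1,2) assms(3,3)] by simp

lemma l2_norm_eq_0_iff:
  assumes "f \<in> L2 \<rho>"
  shows "l2_norm \<rho> f = 0 \<longleftrightarrow> (AE x in \<rho>. f x = 0)"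
proof -
  have "l2_norm \<rho> f = 0 \<longleftrightarrow> (LINT x|\<rho>. f x \<bullet> f x) = 0"
    by (simp add: l2_norm_def l2_inner_def)
  also have "\<dots> \<longleftrightarrow> (AE x in \<rho>. f x \<bullet> f x = 0)"
    using L2_integrable_inner[OF assms assms] by (intro integral_nonneg_eq_0_iff_AE) auto
  finally show ?thesis by simp
qed

lemma l2_cauchy_schwarz:
  assumes "f \<in> L2 \<rho>" "g \<in> L2 \<rho>"
  shows "\<bar>l2_inner \<rho> f g\<bar> \<le> l2_norm \<rho> f * l2_norm \<rho> g"
proof (cases "l2_norm \<rho> g = 0")
  case True
  then have "AE x in \<rho>. g x = 0"
    using assms by (simp add: l2_norm_eq_0_iff)
  then have "l2_inner \<rho> f g = 0"
    unfolding l2_inner_def by (intro integral_eq_zero_AE) auto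
  then show ?thesis
    by (simp add: True)
next
  case False
  define b c where "b = l2_inner \<rho> f g" and "c = l2_inner \<rho> g g"
  have c: "c > 0"
    using False by (simp add: c_def l2_norm_nonneg flip: l2_norm_power2)
  \<comment> \<open>\<open>?k\<close> is \<open>c\<close> times the component of \<open>f\<close>
    orthogonal to \<open>g\<close>; the factor \<open>c\<close> avoids a division.\<close>
  let ?k = "\<lambda>x. c *\<^sub>R f x - b *\<^sub>R g x"
  have "0 \<le> l2_inner \<rho> ?k ?k"
    by (rule l2_inner_self_nonneg)
  also have "\<dots> = c * (c * l2_inner \<rho> f f - b * b)"
    using assms by (simp add: l2_inner_diff_left l2_inner_diff_right L2_scaleR L2_diff
      l2_inner_scaleR_left l2_inner_scaleR_right l2_inner_commute[of \<rho> g f] algebra_simps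
      flip: b_def c_def)
  finally have "b\<^sup>2 \<le> c * l2_inner \<rho> f f"
    using c by (simp add: zero_le_mult_iff power2_eq_square)
  also have "\<dots> = (l2_norm \<rho> f * l2_norm \<rho> g)\<^sup>2"
    by (simp add: power_mult_distrib l2_norm_power2 c_def)
  finally have "\<bar>b\<bar> \<le> \<bar>l2_norm \<rho> f * l2_norm \<rho> g\<bar>"
    by (simp only: abs_le_square_iff)
  then show ?thesis
    by (simp add: b_def l2_norm_nonneg)
qed

lemma l2_norm_triangle:
  assumes "f \<in> L2 \<rho>" "g \<in> L2 \<rho>"
  shows "l2_norm \<rho> (\<lambda>x. f x + g x) \<le> l2_norm \<rho> f + l2_norm \<rho> g"
proof (rule power2_le_imp_le)
  have "(l2_norm \<rho> (\<lambda>x. f x + g x))\<^sup>2 = (l2_norm \<rho> f)\<^sup>2 + 2 * l2_inner \<rho> f g + (l2_norm \<rho> g)\<^sup>2"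
    using assms by (simp add: l2_norm_power2 l2_inner_add_left l2_inner_add_right L2_add
      l2_inner_commute[of \<rho> g f])
  also have "\<dots> \<le> (l2_norm \<rho> f + l2_norm \<rho> g)\<^sup>2"
    using l2_cauchy_schwarz[OF assms] by (simp add: power2_sum)
  finally show "(l2_norm \<rho> (\<lambda>x. f x + g x))\<^sup>2 \<le> (l2_norm \<rho> f + l2_norm \<rho> g)\<^sup>2" .
qed (simp add: l2_norm_nonneg)

lemma l2_norm_triangle_diff:
  assumes "f \<in> L2 \<rho>" "g \<in> L2 \<rho>"
  shows "l2_norm \<rho> (\<lambda>x. f x - g x) \<le> l2_norm \<rho> f + l2_norm \<rho> g"
  using l2_norm_triangle[OF assms(1) L2_minus[OF assms(2)]] by (simp add: l2_norm_minus)

lemma L2_bounded: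
  assumes "finite_measure \<rho>" "f \<in> borel_measurable \<rho>" "\<And>x. norm (f x) \<le> B"
  shows "f \<in> L2 \<rho>"
proof -
  interpret finite_measure \<rho> by fact
  have "integrable \<rho> (\<lambda>x. (norm (f x))\<^sup>2)"
    using assms by (intro integrable_const_bound[where B = "B\<^sup>2"]) (auto intro!: power_mono AE_I2)
  then show ?thesis
    using assms by (simp add: L2_def)
qed

lemma l2_norm_le_bound:
  assumes "prob_space \<rho>" "f \<in> borel_measurable \<rho>" "\<And>x. norm (f x) \<le> B"
  shows "l2_norm \<rho> f \<le> B"
proof -
  interpret prob_space \<rho> by fact
  have "0 \<le> B"
    using norm_ge_zero[of "f undefined"] assms(3)[of undefined] by linarith
  have "f \<in> L2 \<rho>"
    using finite_measure_axioms assms(2,3) by (rule L2_bounded)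
  then have "l2_inner \<rho> f f \<le> (LINT x|\<rho>. B\<^sup>2)"
    unfolding l2_inner_def using assms
    by (intro integral_mono L2_integrable_inner)
      (auto simp flip: power2_norm_eq_inner intro!: power_mono)
  then show ?thesis
    unfolding l2_norm_def using \<open>0 \<le> B\<close> by (simp add: real_le_lsqrt prob_space)
qed

subsection \<open>Cells and laws\<close>

text \<open>A hyperplane orthogonal to a coordinate axis is swept across \<open>E\<close>. The mass
  of \<open>E\<close> behind it depends continuously on its position, since hyperplanes are Lebesgue
  null and hence \<open>\<rho>\<close>-null, so the intermediate value theorem yields every
  \<open>r\<close> strictly between the extremes.\<close>

lemma absolutely_continuous_subset_measure:
  fixes \<rho> :: "(real^'d) measure"
  assumes fin: "finite_measure \<rho>" and sets: "sets \<rho> = sets borel"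
    and ac: "absolutely_continuous lborel \<rho>"
    and E: "E \<in> sets \<rho>" and r: "0 \<le> r" "r \<le> measure \<rho> E"
  shows "\<exists>S\<in>sets \<rho>. S \<subseteq> E \<and> measure \<rho> S = r"
proof -
  interpret \<rho>: finite_measure \<rho> by fact
  \<comment> \<open>The extreme values are set apart because the distribution function may attain
    them only in the limit at infinity.\<close>
  consider "r = 0" | "r = measure \<rho> E" | "0 < r" "r < measure \<rho> E"
    using r by linarith
  then show ?thesis
  proof cases
    case 1
    then show ?thesis by (intro bexI[of _ "{}"]) auto
  next
    case 2
    then show ?thesis using E by auto
  next
    case 3
    obtain i :: 'd where True by simp
    \<comment> \<open>The law of one coordinate on \<open>E\<close>, left unnormalised, so that
      \<open>cdf M t\<close> is the mass of the part of \<open>E\<close> with coordinate at most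
      \<open>t\<close>.\<close>
    define M where "M = distr (restrict_space \<rho> E) borel (\<lambda>x. x $ i)"
    have E': "E \<inter> space \<rho> \<in> sets \<rho>" using E by auto
    have [simp]: "space \<rho> = UNIV"
      using sets_eq_imp_space_eq[OF sets] by simp
    have meas: "(\<lambda>x. x $ i) \<in> borel_measurable (restrict_space \<rho> E)"
      by (intro measurable_restrict_space1) (simp add: measurable_cong_sets[OF sets refl])
    have M: "measure M B = measure \<rho> {x \<in> E. x $ i \<in> B}" if "B \<in> sets borel" for B
    proof -
      have "measure M B = measure (restrict_space \<rho> E) {x \<in> E. x $ i \<in> B}"
        unfolding M_def using meas that
        by (subst measure_distr) (auto simp: space_restrict_space vimage_def Int_def conj_commute)
      also have "\<dots> = measure \<rho> {x \<in> E. x $ i \<in> B}"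
        using E' by (subst measure_restrict_space) auto
      finally show ?thesis .
    qed
    interpret M: finite_borel_measure M
    proof -
      have "finite_measure (restrict_space \<rho> E)"
        by (intro finite_measure_restrict_space E \<rho>.finite_measure_axioms)
      then have "finite_measure M"
        unfolding M_def using meas by (intro finite_measure.finite_measure_distr)
      then show "finite_borel_measure M"
        by (simp add: finite_borel_measure_def finite_borel_measure_axioms_def M_def)
    qed
    have cont: "isCont (cdf M) t" for t
    proof -
      have "{x::real^'d. x $ i = t} \<in> null_sets lebesgue"
        using negligible_standard_hyperplane[of "axis i 1 :: real^'d" t]
        by (simp add: negligible_iff_null_sets cart_eq_inner_axis axis_in_Basis_iff)
      moreover have borel: "{x::real^'d. x $ i = t} \<in> sets borel"
        by measurable
      ultimately have "{x::real^'d. x $ i = t} \<in> null_sets lborel"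
        by (auto simp: null_sets_def)
      then have "{x::real^'d. x $ i = t} \<in> null_sets \<rho>"
        using ac by (auto simp: absolutely_continuous_def)
      then have "measure \<rho> {x::real^'d. x $ i = t} = 0"
        by (simp add: null_setsD1 measure_def)
      moreover have "measure \<rho> {x \<in> E. x $ i = t} \<le> measure \<rho> {x. x $ i = t}"
        using borel sets by (intro \<rho>.finite_measure_mono) auto
      ultimately have "measure M {t} = 0"
        using measure_nonneg[of \<rho> "{x \<in> E. x $ i = t}"] by (simp add: M)
      then show ?thesis by (simp add: M.isCont_cdf)
    qed
    have spM: "measure M (space M) = measure \<rho> E"
      using M[of UNIV] by (simp add: M_def)
    obtain a where a: "cdf M a < r"
      using order_tendstoD(2)[OF M.cdf_lim_at_bot \<open>0 < r\<close>]
      by (auto simp: eventually_at_bot_linorder)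
    obtain b where b: "\<And>t. t \<ge> b \<Longrightarrow> r < cdf M t"
      using order_tendstoD(1)[OF M.cdf_lim_at_top, of r] 3 spM
      by (auto simp: eventually_at_top_linorder)
    have "\<exists>t\<ge>a. t \<le> max a b \<and> cdf M t = r"
      using a b[of "max a b"] cont by (intro IVT) auto
    then obtain t where t: "cdf M t = r" by blast
    show ?thesis
    proof (intro bexI conjI)
      show "measure \<rho> {x \<in> E. x $ i \<in> {..t}} = r"
        using t by (simp add: cdf_def M del: atMost_iff)
      have "{x. x $ i \<in> {..t}} \<in> sets \<rho>"
        unfolding sets by measurable
      then have "E \<inter> {x. x $ i \<in> {..t}} \<in> sets \<rho>"
        using E by (intro sets.Int) auto
      then show "{x \<in> E. x $ i \<in> {..t}} \<in> sets \<rho>"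
        by (simp add: Int_def)
    qed auto
  qed
qed

text \<open>A set of the right mass is chosen inside each cell. The cells are disjoint and only
  finitely many are nonempty, so the union of the choices is measurable and meets each cell exactly
  in its own choice.\<close>

lemma split_cells:
  assumes nonatomic: "\<And>E r. E \<in> sets \<rho> \<Longrightarrow> 0 \<le> r \<Longrightarrow> r \<le> measure \<rho> E \<Longrightarrow>
      \<exists>S\<in>sets \<rho>. S \<subseteq> E \<and> measure \<rho> S = r"
    and c: "simple_function \<rho> c"
    and p: "\<And>i. 0 \<le> p i" "\<And>i. p i \<le> (1::real)"
  shows "\<exists>S\<in>sets \<rho>. \<forall>i. measure \<rho> (S \<inter> (c -` {i} \<inter> space \<rho>)) = p i * measure \<rho> (c -` {i} \<inter> space \<rho>)"
proof -
  let ?E = "\<lambda>i. c -` {i} \<inter> space \<rho>"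
  have "\<exists>S\<in>sets \<rho>. S \<subseteq> ?E i \<and> measure \<rho> S = p i * measure \<rho> (?E i)" for i
    using c p by (intro nonatomic) (auto simp: simple_functionD mult_left_le_one_le)
  then obtain S where S: "\<And>i. S i \<in> sets \<rho>" "\<And>i. S i \<subseteq> ?E i"
      "\<And>i. measure \<rho> (S i) = p i * measure \<rho> (?E i)"
    by metis
  let ?S = "\<Union>i\<in>c ` space \<rho>. S i"
  have "measure \<rho> (?S \<inter> ?E i) = p i * measure \<rho> (?E i)" for i
  proof (cases "i \<in> c ` space \<rho>")
    case True
    then have "?S \<inter> ?E i = S i"
      using S(2) by fastforce
    then show ?thesis using S(3) by simp
  next
    case False
    then have "?E i = {}" by auto
    then show ?thesis by simp
  qed
  moreover have "?S \<in> sets \<rho>"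
    using simple_functionD(1)[OF c] S(1) by (intro sets.finite_UN) auto
  ultimately show ?thesis by blast
qed

text \<open>Both maps factor through a finite-valued pair, the cell together with membership in the
  set. The law of that pair is fixed by the masses of its atoms, which are the parts of each cell
  inside and outside the set.\<close>

lemma distr_eq_of_cells:
  assumes fin: "finite_measure \<rho>" and c: "simple_function \<rho> c"
    and S: "S \<in> sets \<rho>" "S' \<in> sets \<rho>"
    and eq: "\<And>i. measure \<rho> (S \<inter> (c -` {i} \<inter> space \<rho>)) = measure \<rho> (S' \<inter> (c -` {i} \<inter> space \<rho>))"
    and z: "\<And>i b. z i b \<in> space N"
  shows "distr \<rho> N (\<lambda>x. z (c x) (x \<in> S)) = distr \<rho> N (\<lambda>x. z (c x) (x \<in> S'))"
proof -
  interpret finite_measure \<rho> by fact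
  let ?Q = "c ` space \<rho> \<times> (UNIV :: bool set)"
  define P where "P T = distr \<rho> (count_space ?Q) (\<lambda>x. (c x, x \<in> T))" for T
  have finQ: "finite ?Q"
    using simple_functionD(1)[OF c] by simp
  have cell: "c -` {i} \<inter> space \<rho> \<in> sets \<rho>" for i
    using c by (rule simple_functionD)
  have vim: "(\<lambda>x. (c x, x \<in> T)) -` {(i, b)} \<inter> space \<rho> =
      (if b then T \<inter> (c -` {i} \<inter> space \<rho>) else (c -` {i} \<inter> space \<rho>) - T \<inter> (c -` {i} \<inter> space \<rho>))"
    for T i b by auto
  have meas: "(\<lambda>x. (c x, x \<in> T)) \<in> measurable \<rho> (count_space ?Q)" if "T \<in> sets \<rho>" for T
  proof (subst measurable_count_space_eq2[OF finQ], intro conjI ballI)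
    fix q assume "q \<in> ?Q"
    then obtain i b where "q = (i, b)" by auto
    then show "(\<lambda>x. (c x, x \<in> T)) -` {q} \<inter> space \<rho> \<in> sets \<rho>"
      using that cell by (simp add: vim sets.Diff sets.Int)
  qed auto
  have "P S = P S'"
  proof (rule measure_eqI_finite)
    fix q assume "q \<in> ?Q"
    then obtain i b where q: "q = (i, b)" "(i, b) \<in> ?Q" by auto
    have emP: "emeasure (P T) {q} = ennreal (measure \<rho> ((\<lambda>x. (c x, x \<in> T)) -` {(i, b)} \<inter> space \<rho>))"
      if "T \<in> sets \<rho>" for T
      using meas[OF that] q by (simp add: P_def emeasure_distr emeasure_eq_measure)
    have "measure \<rho> ((c -` {i} \<inter> space \<rho>) - T \<inter> (c -` {i} \<inter> space \<rho>)) =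
      measure \<rho> (c -` {i} \<inter> space \<rho>) - measure \<rho> (T \<inter> (c -` {i} \<inter> space \<rho>))" if "T \<in> sets \<rho>" for T
      using that cell by (intro finite_measure_Diff) auto
    then show "emeasure (P S) {q} = emeasure (P S') {q}"
      using S eq[of i] by (simp add: emP vim)
  qed (use finQ in \<open>auto simp: P_def\<close>)
  moreover have "distr \<rho> N (\<lambda>x. z (c x) (x \<in> T)) = distr (P T) N (\<lambda>q. z (fst q) (snd q))" if "T \<in> sets \<rho>" for T
    unfolding P_def using z meas[OF that] by (subst distr_distr) (auto simp: comp_def)
  ultimately show ?thesis using S by simp
qed

text \<open>The deviation of an indicator from its cell proportions integrates to zero over each
  cell, hence is orthogonal to every function of \<open>c\<close>.\<close>

lemma integral_cell_deviation:
  fixes z p :: "'c \<Rightarrow> real"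
  assumes fin: "finite_measure \<rho>" and c: "simple_function \<rho> c" and S: "S \<in> sets \<rho>"
    and p: "\<And>i. measure \<rho> (S \<inter> (c -` {i} \<inter> space \<rho>)) = p i * measure \<rho> (c -` {i} \<inter> space \<rho>)"
  shows "(LINT x|\<rho>. z (c x) * (indicator S x - p (c x))) = 0"
proof -
  interpret finite_measure \<rho> by fact
  let ?E = "\<lambda>i. c -` {i} \<inter> space \<rho>"
  have finc: "finite (c ` space \<rho>)" and cell: "?E i \<in> sets \<rho>" for i
    using c by (auto dest: simple_functionD)
  have "(LINT x|\<rho>. z (c x) * (indicator S x - p (c x))) =
    (LINT x|\<rho>. (\<Sum>i\<in>c ` space \<rho>. z i * (indicator (S \<inter> ?E i) x - p i * indicator (?E i) x)))"
  proof (rule Bochner_Integration.integral_cong[OF refl])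
    fix x assume x: "x \<in> space \<rho>"
    have "(\<Sum>i\<in>c ` space \<rho>. z i * (indicator (S \<inter> ?E i) x - p i * indicator (?E i) x)) =
      (\<Sum>i\<in>c ` space \<rho>. if i = c x then z (c x) * (indicator S x - p (c x)) else 0)"
      using x by (intro sum.cong) (auto simp: indicator_def)
    also have "\<dots> = z (c x) * (indicator S x - p (c x))"
      using finc x by simp
    finally show "z (c x) * (indicator S x - p (c x)) =
      (\<Sum>i\<in>c ` space \<rho>. z i * (indicator (S \<inter> ?E i) x - p i * indicator (?E i) x))" by simp
  qed
  also have "\<dots> = (\<Sum>i\<in>c ` space \<rho>. z i * (measure \<rho> (S \<inter> ?E i) - p i * measure \<rho> (?E i)))"
    using cell S by (subst Bochner_Integration.integral_sum)
      (auto intro!: sum.cong simp: integral_indicator emeasure_eq_measure integrable_real_indicator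
        Int_absorb1 Int_assoc)
  finally show ?thesis by (simp add: p)
qed

lemma borel_measurable_simple_function_compose:
  "simple_function M c \<Longrightarrow> (\<lambda>x. z (c x)) \<in> measurable M (borel :: 'a::topological_space measure)"
  by (intro borel_measurable_simple_function) (auto dest: simple_function_compose1)

text \<open>The functional \<open>A\<close> takes nearly the same value on all sets with given cell proportions, hence
  nearly \<open>N\<close> times the value in question on a sum \<open>u\<close> of \<open>N\<close> orthogonal deviations; the norm of
  \<open>u\<close> only grows like the square root of \<open>N\<close>. Orthogonality is achieved by refining the cells with
  the current \<open>u\<close> before choosing the next set.\<close>

lemma indicator_cell_mean:
  fixes \<rho> :: "(real^'d) measure" and v :: "real^'d" and c :: "real^'d \<Rightarrow> 'c"
  assumes prob: "prob_space \<rho>"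
    and nonatomic: "\<And>E r. E \<in> sets \<rho> \<Longrightarrow> 0 \<le> r \<Longrightarrow> r \<le> measure \<rho> E \<Longrightarrow>
      \<exists>S\<in>sets \<rho>. S \<subseteq> E \<and> measure \<rho> S = r"
    and lin: "\<And>a b g h. g \<in> L2 \<rho> \<Longrightarrow> h \<in> L2 \<rho> \<Longrightarrow> A (\<lambda>x. a *\<^sub>R g x + b *\<^sub>R h x) = a * A g + b * A h"
    and bdd: "\<And>g. g \<in> L2 \<rho> \<Longrightarrow> \<bar>A g\<bar> \<le> C * l2_norm \<rho> g"
    and c: "simple_function \<rho> c" and S: "S \<in> sets \<rho>"
    and p: "\<And>i. 0 \<le> p i" "\<And>i. p i \<le> (1::real)"
    and Sp: "\<And>i. measure \<rho> (S \<inter> (c -` {i} \<inter> space \<rho>)) = p i * measure \<rho> (c -` {i} \<inter> space \<rho>)"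
    and inv: "\<And>S'. S' \<in> sets \<rho> \<Longrightarrow>
      (\<And>i. measure \<rho> (S' \<inter> (c -` {i} \<inter> space \<rho>)) = measure \<rho> (S \<inter> (c -` {i} \<inter> space \<rho>))) \<Longrightarrow>
      \<bar>A (\<lambda>x. indicator S' x *\<^sub>R v) - A (\<lambda>x. indicator S x *\<^sub>R v)\<bar> \<le> \<eta>"
  shows "\<bar>A (\<lambda>x. indicator S x *\<^sub>R v) - A (\<lambda>x. p (c x) *\<^sub>R v)\<bar> \<le> \<eta>"
proof -
  interpret prob_space \<rho> by fact
  define \<beta> where "\<beta> = A (\<lambda>x. indicator S x *\<^sub>R v) - A (\<lambda>x. p (c x) *\<^sub>R v)"
  have bL2: "(\<lambda>x. u x *\<^sub>R v) \<in> L2 \<rho>" if "u \<in> borel_measurable \<rho>" "\<And>x. \<bar>u x\<bar> \<le> b" for u b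
    using that by (intro L2_bounded[where B = "b * norm v"] finite_measure_axioms)
      (auto intro!: mult_right_mono)
  have pm: "(\<lambda>x. p (c x)) \<in> borel_measurable \<rho>"
    using c by (rule borel_measurable_simple_function_compose)
  have pL2: "(\<lambda>x. p (c x) *\<^sub>R v) \<in> L2 \<rho>"
    using p by (intro bL2[of _ 1] pm) simp
  have iL2: "(\<lambda>x. indicator T x *\<^sub>R v) \<in> L2 \<rho>" if "T \<in> sets \<rho>" for T
    using that by (intro bL2[of _ 1]) (auto simp: indicator_def)
  have step: "\<exists>u. simple_function \<rho> u \<and> (\<forall>x. \<bar>u x\<bar> \<le> real N) \<and> (LINT x|\<rho>. (u x)\<^sup>2) \<le> real N \<and>
    \<bar>A (\<lambda>x. u x *\<^sub>R v) - real N * \<beta>\<bar> \<le> real N * \<eta>" for N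
  proof (induction N)
    case 0
    have "A (\<lambda>x. 0) = 0"
      using lin[OF pL2 pL2, of 0 0] by simp
    then show ?case by (intro exI[of _ "\<lambda>x. 0"]) simp
  next
    case (Suc N)
    then obtain u where u: "simple_function \<rho> u" "\<And>x. \<bar>u x\<bar> \<le> real N" "(LINT x|\<rho>. (u x)\<^sup>2) \<le> real N"
      "\<bar>A (\<lambda>x. u x *\<^sub>R v) - real N * \<beta>\<bar> \<le> real N * \<eta>" by blast
    let ?c = "\<lambda>x. (c x, u x)"
    have c': "simple_function \<rho> ?c"
      using c u(1) by (rule simple_function_Pair)
    obtain T where T: "T \<in> sets \<rho>"
      "\<And>i. measure \<rho> (T \<inter> (?c -` {i} \<inter> space \<rho>)) = p (fst i) * measure \<rho> (?c -` {i} \<inter> space \<rho>)"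
      using split_cells[OF nonatomic c', of "\<lambda>i. p (fst i)"] p by blast
    define d where "d x = indicator T x - p (c x)" for x
    have dm: "d \<in> borel_measurable \<rho>"
      unfolding d_def using pm T(1) by measurable
    have um: "u \<in> borel_measurable \<rho>"
      using u(1) by (rule borel_measurable_simple_function)
    have dle: "\<bar>d x\<bar> \<le> 1" for x
      using p(1)[of "c x"] p(2)[of "c x"] by (auto simp: d_def indicator_def)
    \<comment> \<open>The test function may use both components of the refined cell: the second
      gives orthogonality to \<open>u\<close>, and the indicator of a value of the first gives the
      proportions of \<open>T\<close> on the original cells.\<close>
    have orth: "(LINT x|\<rho>. z (c x) (u x) * d x) = 0" for z
      using integral_cell_deviation[OF finite_measure_axioms c' T(1), of "\<lambda>i. p (fst i)" "\<lambda>q. z (fst q) (snd q)"] T(2)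
      by (simp add: d_def)
    \<comment> \<open>Correct proportions on the refined cells add up to correct ones on the
      original cells, so \<open>inv\<close> applies to \<open>T\<close>.\<close>
    have Tc: "measure \<rho> (T \<inter> (c -` {i} \<inter> space \<rho>)) = measure \<rho> (S \<inter> (c -` {i} \<inter> space \<rho>))" for i
    proof -
      have cell: "c -` {i} \<inter> space \<rho> \<in> sets \<rho>"
        using c by (rule simple_functionD)
      have "0 = (LINT x|\<rho>. indicator {i} (c x) * d x)"
        using orth[of "\<lambda>j _. indicator {i} j"] by simp
      also have "\<dots> = (LINT x|\<rho>. indicator (T \<inter> (c -` {i} \<inter> space \<rho>)) x - p i * indicator (c -` {i} \<inter> space \<rho>) x)"
        by (intro Bochner_Integration.integral_cong) (auto simp: d_def indicator_def)
      also have "\<dots> = measure \<rho> (T \<inter> (c -` {i} \<inter> space \<rho>)) - p i * measure \<rho> (c -` {i} \<inter> space \<rho>)"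
        using cell T(1) by (subst Bochner_Integration.integral_diff)
          (auto simp: integrable_real_indicator emeasure_eq_measure Int_assoc Int_absorb1)
      finally show ?thesis by (simp add: Sp)
    qed
    let ?u = "\<lambda>x. u x + d x"
    have "simple_function \<rho> d"
      unfolding d_def using T(1) c by (intro simple_function_diff simple_function_indicator)
        (auto dest: simple_function_compose1)
    then have "simple_function \<rho> ?u"
      using u(1) by (intro simple_function_add)
    moreover have "\<bar>?u x\<bar> \<le> real (Suc N)" for x
      using u(2)[of x] dle[of x] by linarith
    moreover have "(LINT x|\<rho>. (?u x)\<^sup>2) \<le> real (Suc N)"
    proof -
      have int: "integrable \<rho> (\<lambda>x. (u x)\<^sup>2)" "integrable \<rho> (\<lambda>x. u x * d x)" "integrable \<rho> (\<lambda>x. (d x)\<^sup>2)"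
      proof -
        show "integrable \<rho> (\<lambda>x. (u x)\<^sup>2)"
          using u(2) um by (intro integrable_const_bound[where B = "(real N)\<^sup>2"] AE_I2)
            (simp_all flip: abs_le_square_iff)
        show "integrable \<rho> (\<lambda>x. u x * d x)"
          using u(2) um dm dle by (intro integrable_const_bound[where B = "real N * 1"] AE_I2)
            (auto simp del: mult_1_right simp add: abs_mult intro!: mult_mono)
        show "integrable \<rho> (\<lambda>x. (d x)\<^sup>2)"
          using dm dle by (intro integrable_const_bound[where B = 1] AE_I2)
            (auto simp: abs_square_le_1)
      qed
      have "(LINT x|\<rho>. (?u x)\<^sup>2) = (LINT x|\<rho>. (u x)\<^sup>2 + 2 * (u x * d x) + (d x)\<^sup>2)"
        by (intro Bochner_Integration.integral_cong) (auto simp: power2_sum)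
      also have "\<dots> = (LINT x|\<rho>. (u x)\<^sup>2) + 2 * (LINT x|\<rho>. u x * d x) + (LINT x|\<rho>. (d x)\<^sup>2)"
        using int by simp
      also have "\<dots> = (LINT x|\<rho>. (u x)\<^sup>2) + (LINT x|\<rho>. (d x)\<^sup>2)"
        using orth[of "\<lambda>_ y. y"] by simp
      also have "(LINT x|\<rho>. (d x)\<^sup>2) \<le> (LINT x|\<rho>. 1)"
        using int dle by (intro integral_mono) (auto simp: abs_square_le_1)
      finally show ?thesis using u(3) by (simp add: prob_space)
    qed
    moreover have "\<bar>A (\<lambda>x. ?u x *\<^sub>R v) - real (Suc N) * \<beta>\<bar> \<le> real (Suc N) * \<eta>"
    proof -
      have dL2: "(\<lambda>x. d x *\<^sub>R v) \<in> L2 \<rho>"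
        using dm dle by (rule bL2)
      have "A (\<lambda>x. ?u x *\<^sub>R v) = A (\<lambda>x. u x *\<^sub>R v) + A (\<lambda>x. d x *\<^sub>R v)"
        using lin[OF bL2[OF um u(2)] dL2, of 1 1] by (simp add: scaleR_add_left)
      moreover have "A (\<lambda>x. d x *\<^sub>R v) = A (\<lambda>x. indicator T x *\<^sub>R v) - A (\<lambda>x. p (c x) *\<^sub>R v)"
        using lin[OF iL2[OF T(1)] pL2, of 1 "-1"] by (simp add: d_def scaleR_diff_left)
      moreover have "\<bar>A (\<lambda>x. indicator T x *\<^sub>R v) - A (\<lambda>x. indicator S x *\<^sub>R v)\<bar> \<le> \<eta>"
        using T(1) Tc by (intro inv)
      ultimately show ?thesis using u(4) unfolding \<beta>_def by (simp add: algebra_simps abs_le_iff)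
    qed
    ultimately show ?case by blast
  qed
  \<comment> \<open>The value of \<open>A\<close> on the sum is at least \<open>?N\<close> times
    \<open>\<bar>\<beta>\<bar> - \<eta>\<close> in absolute value, while boundedness caps it at
    order \<open>sqrt ?N\<close>. Dividing by \<open>?N\<close> leaves a bound that tends to
    zero.\<close>
  have "\<bar>\<beta>\<bar> - \<eta> \<le> \<bar>C\<bar> * norm v / sqrt (real (Suc N))" for N
  proof -
    let ?N = "real (Suc N)"
    obtain u where u: "simple_function \<rho> u" "\<And>x. \<bar>u x\<bar> \<le> ?N" "(LINT x|\<rho>. (u x)\<^sup>2) \<le> ?N"
      "\<bar>A (\<lambda>x. u x *\<^sub>R v) - ?N * \<beta>\<bar> \<le> ?N * \<eta>" using step[of "Suc N"] by blast
    have "l2_inner \<rho> (\<lambda>x. u x *\<^sub>R v) (\<lambda>x. u x *\<^sub>R v) = (LINT x|\<rho>. (u x)\<^sup>2) * (norm v)\<^sup>2"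
    proof -
      have "(u x *\<^sub>R v) \<bullet> (u x *\<^sub>R v) = (u x)\<^sup>2 * (norm v)\<^sup>2" for x
        by (simp add: dot_square_norm power2_eq_square)
      then show ?thesis by (simp only: l2_inner_def integral_mult_left_zero)
    qed
    then have "l2_norm \<rho> (\<lambda>x. u x *\<^sub>R v) \<le> sqrt (?N * (norm v)\<^sup>2)"
      unfolding l2_norm_def using u(3) by (auto intro!: mult_right_mono)
    then have "\<bar>C\<bar> * l2_norm \<rho> (\<lambda>x. u x *\<^sub>R v) \<le> \<bar>C\<bar> * (sqrt ?N * norm v)"
      by (intro mult_left_mono) (auto simp: real_sqrt_mult)
    moreover have "\<bar>A (\<lambda>x. u x *\<^sub>R v)\<bar> \<le> \<bar>C\<bar> * l2_norm \<rho> (\<lambda>x. u x *\<^sub>R v)"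
      using bdd[OF bL2[OF borel_measurable_simple_function[OF u(1)] u(2)]]
        mult_right_mono[OF abs_ge_self[of C] l2_norm_nonneg[of \<rho> "\<lambda>x. u x *\<^sub>R v"]] by linarith
    moreover have "?N * \<bar>\<beta>\<bar> = \<bar>?N * \<beta>\<bar>" by (simp add: abs_mult)
    ultimately have "?N * \<bar>\<beta>\<bar> - ?N * \<eta> \<le> \<bar>C\<bar> * (sqrt ?N * norm v)"
      using u(4) by linarith
    also have "\<bar>C\<bar> * (sqrt ?N * norm v) = \<bar>C\<bar> * (?N / sqrt ?N * norm v)"
      by (simp only: real_div_sqrt of_nat_0_le_iff)
    finally have "?N * (\<bar>\<beta>\<bar> - \<eta>) \<le> ?N * (\<bar>C\<bar> * norm v / sqrt ?N)"
      by (simp add: right_diff_distrib mult_ac del: of_nat_Suc)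
    then show ?thesis by (rule mult_left_le_imp_le) simp
  qed
  moreover have "(\<lambda>N. \<bar>C\<bar> * norm v / sqrt (real (Suc N))) \<longlonglongrightarrow> 0"
    by real_asymp
  ultimately have "\<bar>\<beta>\<bar> - \<eta> \<le> 0"
    by (intro LIMSEQ_le_const[of _ 0]) auto
  then show ?thesis by (simp add: \<beta>_def)
qed

subsection \<open>The differential of a law invariant functional\<close>

lemma l2_norm_distr:
  assumes "f \<in> borel_measurable \<rho>" "g \<in> borel_measurable borel"
  shows "l2_norm (distr \<rho> borel f) g = l2_norm \<rho> (\<lambda>x. g (f x))"
  using assms by (simp add: l2_norm_def l2_inner_def integral_distr)

lemma l2_inner_distr:
  assumes "f \<in> borel_measurable \<rho>" "g \<in> borel_measurable borel" "h \<in> borel_measurable borel"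
  shows "l2_inner (distr \<rho> borel f) g h = l2_inner \<rho> (\<lambda>x. g (f x)) (\<lambda>x. h (f x))"
  using assms by (simp add: l2_inner_def integral_distr)

text \<open>The approximants converge pointwise with norm at most twice that of \<open>h\<close>, so
  the squared error is dominated by nine times \<open>(norm (h x))\<^sup>2\<close> and dominated
  convergence applies.\<close>

lemma L2_simple_approximation:
  fixes h :: "real^'d \<Rightarrow> real^'d"
  assumes h: "h \<in> L2 \<rho>" and "e > 0"
  shows "\<exists>s. simple_function \<rho> s \<and> s \<in> L2 \<rho> \<and> l2_norm \<rho> (\<lambda>x. s x - h x) < e"
proof -
  have hm: "h \<in> borel_measurable \<rho>"
    using h by (rule L2_measurable)
  obtain s where s: "\<And>i. simple_function \<rho> (s i)" "\<And>x. x \<in> space \<rho> \<Longrightarrow> (\<lambda>i. s i x) \<longlonglongrightarrow> h x"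
    "\<And>i x. x \<in> space \<rho> \<Longrightarrow> norm (s i x) \<le> 2 * norm (h x)"
    using borel_measurable_implies_sequence_metric[OF hm, of 0] unfolding norm_conv_dist by metis
  have sm: "s i \<in> borel_measurable \<rho>" for i
    using s(1) by (rule borel_measurable_simple_function)
  have hint: "integrable \<rho> (\<lambda>x. (norm (h x))\<^sup>2)"
    using h by (simp add: L2_def)
  have sL2: "s i \<in> L2 \<rho>" for i
  proof -
    have "integrable \<rho> (\<lambda>x. (norm (s i x))\<^sup>2)"
    proof (rule Bochner_Integration.integrable_bound)
      show "AE x in \<rho>. norm ((norm (s i x))\<^sup>2) \<le> norm (4 * (norm (h x))\<^sup>2)"
        using power_mono[OF s(3) norm_ge_zero, of _ i 2] by (auto simp: power_mult_distrib intro!: AE_I2)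
    qed (use hint sm in auto)
    then show ?thesis using sm by (simp add: L2_def)
  qed
  have "(\<lambda>i. LINT x|\<rho>. (norm (s i x - h x))\<^sup>2) \<longlonglongrightarrow> (LINT x|\<rho>. 0)"
  proof (rule integral_dominated_convergence)
    show "integrable \<rho> (\<lambda>x. 9 * (norm (h x))\<^sup>2)"
      using hint by simp
    show "AE x in \<rho>. (\<lambda>i. (norm (s i x - h x))\<^sup>2) \<longlonglongrightarrow> 0"
    proof (rule AE_I2)
      fix x assume "x \<in> space \<rho>"
      then have "(\<lambda>i. (norm (s i x - h x))\<^sup>2) \<longlonglongrightarrow> (norm (h x - h x))\<^sup>2"
        by (intro tendsto_intros s(2))
      then show "(\<lambda>i. (norm (s i x - h x))\<^sup>2) \<longlonglongrightarrow> 0" by simp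
    qed
    show "AE x in \<rho>. norm ((norm (s i x - h x))\<^sup>2) \<le> 9 * (norm (h x))\<^sup>2" for i
    proof (rule AE_I2)
      fix x assume x: "x \<in> space \<rho>"
      have "norm (s i x - h x) \<le> 3 * norm (h x)"
        using norm_triangle_ineq4[of "s i x" "h x"] s(3)[OF x, of i] by linarith
      from power_mono[OF this norm_ge_zero, of 2]
      show "norm ((norm (s i x - h x))\<^sup>2) \<le> 9 * (norm (h x))\<^sup>2"
        by (simp add: power_mult_distrib)
    qed
  qed (use sm hm in auto)
  then have "(\<lambda>i. l2_norm \<rho> (\<lambda>x. s i x - h x)) \<longlonglongrightarrow> sqrt 0"
    unfolding l2_norm_def l2_inner_def power2_norm_eq_inner by (intro tendsto_real_sqrt) simp
  from order_tendstoD(2)[OF this, of e] \<open>e > 0\<close>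
  obtain i where "l2_norm \<rho> (\<lambda>x. s i x - h x) < e"
    by (auto simp: eventually_sequentially)
  then show ?thesis using s(1) sL2 by blast
qed

lemma L2_indicator:
  fixes v :: "real^'d"
  assumes "finite_measure \<rho>" "S \<in> sets \<rho>"
  shows "(\<lambda>x. indicator S x *\<^sub>R v) \<in> L2 \<rho>"
  using assms by (intro L2_bounded[where B = "norm v"]) (auto simp: indicator_def)

text \<open>Linearity carries the vanishing from indicators to simple functions, and boundedness
  carries it to their limits in \<open>L2 \<rho>\<close>.\<close>

lemma l2_functional_zero_of_indicators:
  fixes \<rho> :: "(real^'d) measure" and B :: "(real^'d \<Rightarrow> real^'d) \<Rightarrow> real"
  assumes fin: "finite_measure \<rho>"
    and lin: "\<And>a b g h. g \<in> L2 \<rho> \<Longrightarrow> h \<in> L2 \<rho> \<Longrightarrow> B (\<lambda>x. a *\<^sub>R g x + b *\<^sub>R h x) = a * B g + b * B h"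
    and bdd: "\<And>g. g \<in> L2 \<rho> \<Longrightarrow> \<bar>B g\<bar> \<le> C * l2_norm \<rho> g"
    and ind: "\<And>S v. S \<in> sets \<rho> \<Longrightarrow> B (\<lambda>x. indicator S x *\<^sub>R v) = 0"
    and space: "space \<rho> = UNIV" and h: "h \<in> L2 \<rho>"
  shows "B h = 0"
proof -
  have L2i: "(\<lambda>x. indicator S x *\<^sub>R v) \<in> L2 \<rho>" if "S \<in> sets \<rho>" for S and v :: "real^'d"
    using fin that by (rule L2_indicator)
  have sums: "(\<lambda>x. \<Sum>v\<in>W. indicator (s -` {v}) x *\<^sub>R v) \<in> L2 \<rho> \<and>
      B (\<lambda>x. \<Sum>v\<in>W. indicator (s -` {v}) x *\<^sub>R v) = 0"
    if "simple_function \<rho> s" "finite W" for s :: "real^'d \<Rightarrow> real^'d" and W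
    using \<open>finite W\<close>
  proof induction
    case empty
    show ?case
      using ind[of "{}" 0] L2i[of "{}" 0] by simp
  next
    case (insert v W)
    have sv: "s -` {v} \<in> sets \<rho>"
      using simple_functionD(2)[OF \<open>simple_function \<rho> s\<close>, of "{v}"] space by simp
    have sum: "(\<lambda>x. \<Sum>v\<in>insert v W. indicator (s -` {v}) x *\<^sub>R v) =
        (\<lambda>x. indicator (s -` {v}) x *\<^sub>R v + (\<Sum>v\<in>W. indicator (s -` {v}) x *\<^sub>R v))"
      by (intro ext sum.insert insert.hyps)
    show ?case
      unfolding sum
      using insert.IH L2_add[OF L2i[OF sv, of v], of "\<lambda>x. \<Sum>v\<in>W. indicator (s -` {v}) x *\<^sub>R v"]
        lin[OF L2i[OF sv, of v], of "\<lambda>x. \<Sum>v\<in>W. indicator (s -` {v}) x *\<^sub>R v" 1 1] ind[OF sv, of v]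
      by simp
  qed
  have simple: "B s = 0" if "simple_function \<rho> s" for s
  proof -
    have fins: "finite (range s)"
      using simple_functionD(1)[OF that] space by simp
    have "(\<lambda>x. \<Sum>v\<in>range s. indicator (s -` {v}) x *\<^sub>R v) = s"
    proof
      fix x
      have "(\<Sum>v\<in>range s. indicator (s -` {v}) x *\<^sub>R v) = (\<Sum>v\<in>range s. if v = s x then v else 0)"
        by (intro sum.cong) (auto simp: indicator_def)
      then show "(\<Sum>v\<in>range s. indicator (s -` {v}) x *\<^sub>R v) = s x"
        using fins by simp
    qed
    then show ?thesis using sums[OF that fins] by simp
  qed
  have "\<bar>B h\<bar> \<le> 0 + e" if "e > 0" for e
  proof -
    have "e / (\<bar>C\<bar> + 1) > 0" using that by simp
    then obtain s where s: "simple_function \<rho> s" "s \<in> L2 \<rho>" "l2_norm \<rho> (\<lambda>x. s x - h x) < e / (\<bar>C\<bar> + 1)"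
      using L2_simple_approximation[OF h] by blast
    have "B (\<lambda>x. s x - h x) = - B h"
      using lin[OF s(2) h, of 1 "-1"] simple[OF s(1)] by simp
    then have "\<bar>B h\<bar> \<le> C * l2_norm \<rho> (\<lambda>x. s x - h x)"
      using bdd[OF L2_diff[OF s(2) h]] by simp
    also have "\<dots> \<le> (\<bar>C\<bar> + 1) * (e / (\<bar>C\<bar> + 1))"
      using s(3) l2_norm_nonneg[of \<rho> "\<lambda>x. s x - h x"] by (intro mult_mono) auto
    finally show ?thesis by simp
  qed
  then have "\<bar>B h\<bar> \<le> 0" by (rule field_le_epsilon)
  then show ?thesis by simp
qed

text \<open>Perturbing the cell-wise constant approximation of \<open>f\<close> by \<open>t\<close>
  times either indicator gives the same law, hence the same value of \<open>F\<close>; comparing the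
  two first-order expansions bounds the difference of the differentials. The approximation error is
  at most \<open>t\<close>, of the order of the perturbation, so dividing by \<open>t\<close> leaves
  an error of order \<open>e\<close>.\<close>

lemma derivative_nearly_invariant:
  fixes \<rho> :: "(real^'d) measure" and v :: "real^'d" and c :: "real^'d \<Rightarrow> 'c"
  assumes prob: "prob_space \<rho>" and f: "f \<in> L2 \<rho>"
    and lin: "\<And>a b g h. g \<in> L2 \<rho> \<Longrightarrow> h \<in> L2 \<rho> \<Longrightarrow> A (\<lambda>x. a *\<^sub>R g x + b *\<^sub>R h x) = a * A g + b * A h"
    and exp: "\<And>g. g \<in> L2 \<rho> \<Longrightarrow> l2_norm \<rho> g < d \<Longrightarrow>
      \<bar>F (pushforward (\<lambda>x. f x + g x) \<rho>) - F (pushforward f \<rho>) - A g\<bar> \<le> e * l2_norm \<rho> g"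
    and e: "e > 0"
    and c: "simple_function \<rho> c" and a: "(\<lambda>x. a (c x)) \<in> L2 \<rho>"
    and near: "l2_norm \<rho> (\<lambda>x. a (c x) - f x) \<le> t" and t: "0 < t" "t * (1 + norm v) < d"
    and S: "S \<in> sets \<rho>" "S' \<in> sets \<rho>"
    and eq: "\<And>i. measure \<rho> (S \<inter> (c -` {i} \<inter> space \<rho>)) = measure \<rho> (S' \<inter> (c -` {i} \<inter> space \<rho>))"
  shows "\<bar>A (\<lambda>x. indicator S x *\<^sub>R v) - A (\<lambda>x. indicator S' x *\<^sub>R v)\<bar> \<le> 2 * e * (1 + norm v)"
proof -
  interpret prob_space \<rho> by fact
  \<comment> \<open>Chosen so that \<open>f x + g T x\<close> is
    \<open>a (c x) + t *\<^sub>R indicator T x *\<^sub>R v\<close>, which depends only on the cell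
    and on membership in \<open>T\<close>. The first summand is common to \<open>S\<close> and
    \<open>S'\<close> and cancels in the comparison.\<close>
  define g where "g T x = (a (c x) - f x) + t *\<^sub>R indicator T x *\<^sub>R v" for T x
  have iL2: "(\<lambda>x. indicator T x *\<^sub>R v) \<in> L2 \<rho>" if "T \<in> sets \<rho>" for T
    using finite_measure_axioms that by (rule L2_indicator)
  have dL2: "(\<lambda>x. a (c x) - f x) \<in> L2 \<rho>"
    using a f by (rule L2_diff)
  have gL2: "g T \<in> L2 \<rho>" if "T \<in> sets \<rho>" for T
    unfolding g_def using L2_add[OF dL2 L2_scaleR[OF iL2[OF that]]] by simp
  have gnorm: "l2_norm \<rho> (g T) \<le> t * (1 + norm v)" if "T \<in> sets \<rho>" for T
  proof -
    have "l2_norm \<rho> (\<lambda>x. indicator T x *\<^sub>R v) \<le> norm v"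
      using that by (intro l2_norm_le_bound prob) (auto simp: indicator_def)
    then have "t * l2_norm \<rho> (\<lambda>x. indicator T x *\<^sub>R v) \<le> t * norm v"
      using t by (intro mult_left_mono) auto
    moreover have "l2_norm \<rho> (g T) \<le> l2_norm \<rho> (\<lambda>x. a (c x) - f x) + t * l2_norm \<rho> (\<lambda>x. indicator T x *\<^sub>R v)"
      using l2_norm_triangle[OF dL2 L2_scaleR[OF iL2[OF that], of t]] t
      by (simp only: g_def[abs_def] l2_norm_scaleR abs_of_pos)
    ultimately show ?thesis using near by (simp add: distrib_left)
  qed
  have gA: "A (g T) = A (\<lambda>x. a (c x) - f x) + t * A (\<lambda>x. indicator T x *\<^sub>R v)" if "T \<in> sets \<rho>" for T
    using lin[OF dL2 iL2[OF that], of 1 t] by (simp add: g_def[abs_def])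
  have gexp: "\<bar>F (pushforward (\<lambda>x. f x + g T x) \<rho>) - F (pushforward f \<rho>) - A (g T)\<bar> \<le> e * (t * (1 + norm v))"
    if "T \<in> sets \<rho>" for T
    using exp[OF gL2[OF that]] gnorm[OF that] t mult_left_mono[OF gnorm[OF that], of e] e by linarith
  have law: "pushforward (\<lambda>x. f x + g S x) \<rho> = pushforward (\<lambda>x. f x + g S' x) \<rho>"
  proof -
    have "pushforward (\<lambda>x. f x + g T x) \<rho> = pushforward (\<lambda>x. (\<lambda>i b. a i + (if b then t *\<^sub>R v else 0)) (c x) (x \<in> T)) \<rho>" for T
      by (intro arg_cong[where f = "distr \<rho> borel"] ext) (simp add: g_def indicator_def)
    then show ?thesis
      using distr_eq_of_cells[OF finite_measure_axioms c S eq, of "\<lambda>i b. a i + (if b then t *\<^sub>R v else 0)" borel]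
      by simp
  qed
  have "\<bar>A (g S) - A (g S')\<bar> \<le> 2 * (e * (t * (1 + norm v)))"
    using gexp[OF S(1)] gexp[OF S(2)] law by (simp add: abs_le_iff)
  moreover have "A (g S) - A (g S') = t * (A (\<lambda>x. indicator S x *\<^sub>R v) - A (\<lambda>x. indicator S' x *\<^sub>R v))"
    using S by (simp add: gA algebra_simps)
  ultimately have "t * \<bar>A (\<lambda>x. indicator S x *\<^sub>R v) - A (\<lambda>x. indicator S' x *\<^sub>R v)\<bar> \<le> t * (2 * e * (1 + norm v))"
    using t by (simp add: abs_mult mult_ac)
  then show ?thesis using t by simp
qed

text \<open>It suffices to test the difference of the two functionals on indicators. There the
  indicator is replaced by its cell average, at a small cost for \<open>A\<close> by near invariance
  and for the inner product by orthogonality of the deviation to functions of the cells. On the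
  average, a function of \<open>f\<close>, both functionals agree exactly.\<close>

lemma law_invariant_derivative:
  fixes \<rho> :: "(real^'d) measure" and gr :: "real^'d \<Rightarrow> real^'d"
  assumes prob: "prob_space \<rho>" and space: "space \<rho> = UNIV"
    and nonatomic: "\<And>E r. E \<in> sets \<rho> \<Longrightarrow> 0 \<le> r \<Longrightarrow> r \<le> measure \<rho> E \<Longrightarrow>
      \<exists>S\<in>sets \<rho>. S \<subseteq> E \<and> measure \<rho> S = r"
    and f: "f \<in> L2 \<rho>"
    and lin: "\<And>a b g h. g \<in> L2 \<rho> \<Longrightarrow> h \<in> L2 \<rho> \<Longrightarrow> A (\<lambda>x. a *\<^sub>R g x + b *\<^sub>R h x) = a * A g + b * A h"
    and bdd: "\<And>g. g \<in> L2 \<rho> \<Longrightarrow> \<bar>A g\<bar> \<le> C * l2_norm \<rho> g"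
    and exp: "\<And>e. e > 0 \<Longrightarrow> \<exists>d>0. \<forall>g\<in>L2 \<rho>. l2_norm \<rho> g < d \<longrightarrow>
      \<bar>F (pushforward (\<lambda>x. f x + g x) \<rho>) - F (pushforward f \<rho>) - A g\<bar> \<le> e * l2_norm \<rho> g"
    and gr: "has_wasserstein_gradient F gr (pushforward f \<rho>)"
    and h: "h \<in> L2 \<rho>"
  shows "A h = l2_inner \<rho> (\<lambda>x. gr (f x)) h"
proof -
  interpret prob_space \<rho> by fact
  let ?P = "pushforward f \<rho>"
  let ?w = "\<lambda>x. gr (f x)"
  have fm: "f \<in> borel_measurable \<rho>"
    using f by (rule L2_measurable)
  have grL2: "gr \<in> L2 ?P"
    using gr by (simp add: has_wasserstein_gradient_def)
  then have grm: "gr \<in> borel_measurable borel" and w: "?w \<in> L2 \<rho>"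
    using fm by (simp_all add: L2_distr)
  have along: "A (\<lambda>x. k (f x)) = l2_inner \<rho> ?w (\<lambda>x. k (f x))" if k: "k \<in> L2 ?P" for k
  proof -
    let ?k = "\<lambda>x. k (f x)"
    have km: "k \<in> borel_measurable borel" and kL2: "?k \<in> L2 \<rho>"
      using k fm by (simp_all add: L2_distr)
    have "\<bar>A ?k - l2_inner \<rho> ?w ?k\<bar> \<le> 0 + e" if "e > 0" for e
    proof -
      define e' where "e' = e / (2 * (1 + l2_norm \<rho> ?k))"
      have e': "e' > 0" using that l2_norm_nonneg[of \<rho> ?k] by (simp add: e'_def add_pos_nonneg)
      obtain d1 where d1: "d1 > 0" "\<And>g. g \<in> L2 \<rho> \<Longrightarrow> l2_norm \<rho> g < d1 \<Longrightarrow>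
        \<bar>F (pushforward (\<lambda>x. f x + g x) \<rho>) - F ?P - A g\<bar> \<le> e' * l2_norm \<rho> g"
        using exp[OF e'] by blast
      obtain d2 where d2: "d2 > 0" "\<And>g. g \<in> L2 ?P \<Longrightarrow> l2_norm ?P g < d2 \<Longrightarrow>
        \<bar>F (pushforward (\<lambda>x. x + g x) ?P) - F ?P - l2_inner ?P gr g\<bar> \<le> e' * l2_norm ?P g"
        using gr e' unfolding has_wasserstein_gradient_def by blast
      \<comment> \<open>Makes both expansions applicable to \<open>t\<close> times the direction;
        the added 1 keeps the denominator positive and the norm bound strict.\<close>
      define t where "t = min d1 d2 / (1 + l2_norm \<rho> ?k)"
      have t: "t > 0" using d1 d2 l2_norm_nonneg[of \<rho> ?k] by (simp add: t_def add_pos_nonneg)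
      have "t * (1 + l2_norm \<rho> ?k) = min d1 d2"
        using l2_norm_nonneg[of \<rho> ?k] by (simp add: t_def add_pos_nonneg)
      then have tk: "t * l2_norm \<rho> ?k < min d1 d2"
        using t unfolding distrib_left by linarith
      have n1: "l2_norm \<rho> (\<lambda>x. t *\<^sub>R k (f x)) = t * l2_norm \<rho> ?k"
        using l2_norm_scaleR[of \<rho> t ?k] t by simp
      have n2: "l2_norm ?P (\<lambda>y. t *\<^sub>R k y) = t * l2_norm \<rho> ?k"
        using km by (subst l2_norm_distr[OF fm]) (auto simp: n1)
      have A1: "A (\<lambda>x. t *\<^sub>R k (f x)) = t * A ?k"
        using lin[OF kL2 kL2, of t 0] by simp
      have A2: "l2_inner ?P gr (\<lambda>y. t *\<^sub>R k y) = t * l2_inner \<rho> ?w ?k"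
        using km grm by (subst l2_inner_distr[OF fm]) (auto simp: l2_inner_scaleR_right)
      \<comment> \<open>Displacing the law of \<open>f\<close> along \<open>k\<close> is the same as
        perturbing \<open>f\<close> by \<open>k\<close> composed with \<open>f\<close>, so the two
        expansions concern one and the same value of \<open>F\<close>.\<close>
      have law: "pushforward (\<lambda>y. y + t *\<^sub>R k y) ?P = pushforward (\<lambda>x. f x + t *\<^sub>R k (f x)) \<rho>"
        using km fm by (subst distr_distr) (auto simp: comp_def)
      have "\<bar>F (pushforward (\<lambda>x. f x + t *\<^sub>R k (f x)) \<rho>) - F ?P - t * A ?k\<bar> \<le> e' * (t * l2_norm \<rho> ?k)"
        using d1(2)[OF L2_scaleR[OF kL2, of t]] tk by (simp add: n1 A1)
      moreover have "\<bar>F (pushforward (\<lambda>x. f x + t *\<^sub>R k (f x)) \<rho>) - F ?P - t * l2_inner \<rho> ?w ?k\<bar> \<le> e' * (t * l2_norm \<rho> ?k)"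
        using d2(2)[OF L2_scaleR[OF k, of t]] tk by (simp add: n2 A2 law)
      ultimately have "\<bar>t * A ?k - t * l2_inner \<rho> ?w ?k\<bar> \<le> 2 * (e' * (t * l2_norm \<rho> ?k))"
        by linarith
      then have "t * \<bar>A ?k - l2_inner \<rho> ?w ?k\<bar> \<le> t * (2 * e' * l2_norm \<rho> ?k)"
        using t by (simp add: abs_mult mult_ac flip: right_diff_distrib)
      then have "\<bar>A ?k - l2_inner \<rho> ?w ?k\<bar> \<le> 2 * e' * l2_norm \<rho> ?k"
        using t by simp
      also have "\<dots> \<le> 2 * e' * (1 + l2_norm \<rho> ?k)"
        using e' by simp
      also have "\<dots> = e"
      proof -
        have "1 + l2_norm \<rho> ?k \<noteq> 0"
          using l2_norm_nonneg[of \<rho> ?k] by linarith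
        then show ?thesis by (simp add: e'_def del: distrib_left_numeral)
      qed
      finally show ?thesis by simp
    qed
    then have "\<bar>A ?k - l2_inner \<rho> ?w ?k\<bar> \<le> 0" by (rule field_le_epsilon)
    then show ?thesis by simp
  qed
  define B where "B g = A g - l2_inner \<rho> ?w g" for g
  have "B h = 0"
  proof (rule l2_functional_zero_of_indicators[OF finite_measure_axioms _ _ _ space h])
    fix a b :: real and g h :: "real^'d \<Rightarrow> real^'d" assume gh: "g \<in> L2 \<rho>" "h \<in> L2 \<rho>"
    show "B (\<lambda>x. a *\<^sub>R g x + b *\<^sub>R h x) = a * B g + b * B h"
      using gh w by (simp add: B_def lin l2_inner_add_right l2_inner_scaleR_right L2_scaleR algebra_simps)
  next
    fix g :: "real^'d \<Rightarrow> real^'d" assume g: "g \<in> L2 \<rho>"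
    show "\<bar>B g\<bar> \<le> (C + l2_norm \<rho> ?w) * l2_norm \<rho> g"
      using bdd[OF g] l2_cauchy_schwarz[OF w g] by (simp add: B_def distrib_right)
  next
    fix S and v :: "real^'d" assume S: "S \<in> sets \<rho>"
    have "\<bar>B (\<lambda>x. indicator S x *\<^sub>R v)\<bar> \<le> 0 + \<eta>" if "\<eta> > 0" for \<eta>
    proof -
      \<comment> \<open>Makes the final error \<open>2 * e * (1 + norm v) + e * norm v\<close> equal
        to \<open>\<eta>\<close>.\<close>
      define e where "e = \<eta> / (2 + 3 * norm v)"
      have e: "e > 0" using that by (simp add: e_def add_pos_nonneg)
      obtain d where d: "d > 0" "\<And>g. g \<in> L2 \<rho> \<Longrightarrow> l2_norm \<rho> g < d \<Longrightarrow>
        \<bar>F (pushforward (\<lambda>x. f x + g x) \<rho>) - F ?P - A g\<bar> \<le> e * l2_norm \<rho> g"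
        using exp[OF e] by blast
      \<comment> \<open>The scale is fixed before the cells, because the approximation of
        \<open>f\<close> has to be accurate to within \<open>t\<close>.\<close>
      define t where "t = d / (2 * (1 + norm v))"
      have t: "t > 0" using d by (simp add: t_def add_pos_nonneg)
      have "2 * (t * (1 + norm v)) = d"
        by (simp add: t_def add_nonneg_eq_0_iff del: distrib_left_numeral)
      then have td: "t * (1 + norm v) < d" using d by linarith
      \<comment> \<open>Approximating the identity and \<open>gr\<close> under the law of
        \<open>f\<close>, and only then composing with \<open>f\<close>, yields approximations of
        \<open>f\<close> and \<open>?w\<close> that are functions of \<open>f\<close>.\<close>
      have "(\<lambda>y. y) \<in> L2 ?P"
        using f fm by (simp add: L2_distr)
      from L2_simple_approximation[OF this t] obtain s1 where s1: "simple_function ?P s1" "s1 \<in> L2 ?P"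
        "l2_norm ?P (\<lambda>y. s1 y - y) < t" by blast
      from L2_simple_approximation[OF grL2 e] obtain s2 where s2: "simple_function ?P s2" "s2 \<in> L2 ?P"
        "l2_norm ?P (\<lambda>y. s2 y - gr y) < e" by blast
      \<comment> \<open>The cells are the joint level sets of both approximations: the first
        component serves the equality of laws, the second the orthogonality to the
        deviation.\<close>
      define c where "c x = (s1 (f x), s2 (f x))" for x
      have simple_comp: "simple_function \<rho> (\<lambda>x. s (f x))" if "simple_function ?P s" for s :: "real^'d \<Rightarrow> real^'d"
        using that fm by (intro simple_function_comp[of f \<rho> ?P s, unfolded comp_def]) auto
      have c: "simple_function \<rho> c"
        unfolding c_def using s1(1) s2(1) by (intro simple_function_Pair simple_comp)
      have s1m: "s1 \<in> borel_measurable borel" and s1L2: "(\<lambda>x. s1 (f x)) \<in> L2 \<rho>"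
        using s1(2) fm by (simp_all add: L2_distr)
      have s2m: "s2 \<in> borel_measurable borel" and s2L2: "(\<lambda>x. s2 (f x)) \<in> L2 \<rho>"
        using s2(2) fm by (simp_all add: L2_distr)
      have near1: "l2_norm \<rho> (\<lambda>x. s1 (f x) - f x) \<le> t"
        using s1(3) s1m by (subst (asm) l2_norm_distr[OF fm]) auto
      have near2: "l2_norm \<rho> (\<lambda>x. s2 (f x) - gr (f x)) \<le> e"
        using s2(3) s2m grm by (subst (asm) l2_norm_distr[OF fm]) auto
      let ?E = "\<lambda>i. c -` {i} \<inter> space \<rho>"
      \<comment> \<open>On a null cell the division gives 0, which is consistent with
        \<open>Sp\<close> because \<open>S\<close> then has no mass in that cell either.\<close>
      define p where "p i = measure \<rho> (S \<inter> ?E i) / measure \<rho> (?E i)" for i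
      have le: "measure \<rho> (S \<inter> ?E i) \<le> measure \<rho> (?E i)" for i
        using simple_functionD(2)[OF c] by (intro finite_measure_mono) auto
      have p: "0 \<le> p i" "p i \<le> 1" for i
        using le[of i] by (auto simp: p_def divide_le_eq_1 zero_less_measure_iff)
      have Sp: "measure \<rho> (S \<inter> ?E i) = p i * measure \<rho> (?E i)" for i
        using le[of i] measure_nonneg[of \<rho> "S \<inter> ?E i"] by (cases "measure \<rho> (?E i) = 0") (auto simp: p_def intro: antisym)
      have step: "\<bar>A (\<lambda>x. indicator S x *\<^sub>R v) - A (\<lambda>x. p (c x) *\<^sub>R v)\<bar> \<le> 2 * e * (1 + norm v)"
      proof (rule indicator_cell_mean[OF prob nonatomic lin bdd c S p Sp])
        fix S' assume S': "S' \<in> sets \<rho>" "\<And>i. measure \<rho> (S' \<inter> ?E i) = measure \<rho> (S \<inter> ?E i)"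
        show "\<bar>A (\<lambda>x. indicator S' x *\<^sub>R v) - A (\<lambda>x. indicator S x *\<^sub>R v)\<bar> \<le> 2 * e * (1 + norm v)"
          using s1L2 near1
          by (intro derivative_nearly_invariant[where a = fst, OF prob f lin d(2) e c _ _ t td S'(1) S S'(2)])
            (auto simp: c_def)
      qed
      let ?p = "\<lambda>x. p (c x) *\<^sub>R v"
      \<comment> \<open>The cell average \<open>?p\<close> written as \<open>?q\<close> composed
        with \<open>f\<close>, the form to which \<open>along\<close> applies.\<close>
      let ?q = "\<lambda>y. p (s1 y, s2 y) *\<^sub>R v"
      have finP: "finite_measure ?P"
        using fm by (rule finite_measure_distr)
      have pP: "?q \<in> L2 ?P"
      proof (rule L2_bounded[OF finP])
        have "(\<lambda>y. p (s1 y, s2 y)) \<in> borel_measurable ?P"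
          using simple_function_Pair[OF s1(1) s2(1)] by (rule borel_measurable_simple_function_compose)
        then show "?q \<in> borel_measurable ?P" by (intro borel_measurable_scaleR) auto
        show "norm (?q y) \<le> norm v" for y
          using p by (simp add: mult_left_le_one_le)
      qed
      have pL2: "?p \<in> L2 \<rho>"
        using pP fm by (simp add: L2_distr c_def)
      have Ap: "A ?p = l2_inner \<rho> ?w ?p"
        using along[OF pP] by (simp add: c_def)
      let ?r = "\<lambda>x. indicator S x *\<^sub>R v - p (c x) *\<^sub>R v"
      have SL2: "(\<lambda>x. indicator S x *\<^sub>R v) \<in> L2 \<rho>"
        using finite_measure_axioms S by (rule L2_indicator)
      have rL2: "?r \<in> L2 \<rho>" using SL2 pL2 by (rule L2_diff)
      \<comment> \<open>The deviation \<open>?r\<close> is orthogonal to the approximation of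
        \<open>?w\<close>, so only the approximation error, of norm at most \<open>e\<close>,
        contributes to its inner product with \<open>?w\<close>.\<close>
      have "l2_inner \<rho> (\<lambda>x. s2 (f x)) ?r = (LINT x|\<rho>. (snd (c x) \<bullet> v) * (indicator S x - p (c x)))"
        by (simp add: l2_inner_def c_def inner_diff_right algebra_simps)
      also have "\<dots> = 0"
        using integral_cell_deviation[OF finite_measure_axioms c S Sp, of "\<lambda>i. snd i \<bullet> v"] .
      finally have "l2_inner \<rho> (\<lambda>x. s2 (f x) - gr (f x)) ?r = - l2_inner \<rho> ?w ?r"
        using s2L2 w rL2 by (simp add: l2_inner_diff_left)
      then have "\<bar>l2_inner \<rho> ?w ?r\<bar> \<le> l2_norm \<rho> (\<lambda>x. s2 (f x) - gr (f x)) * l2_norm \<rho> ?r"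
        using l2_cauchy_schwarz[OF L2_diff[OF s2L2 w] rL2] by simp
      also have "\<dots> \<le> e * norm v"
      proof (rule mult_mono)
        have "norm (?r x) \<le> norm v" for x
        proof -
          have "\<bar>indicator S x - p (c x)\<bar> \<le> 1"
            using p[of "c x"] by (auto simp: indicator_def)
          then have "\<bar>indicator S x - p (c x)\<bar> * norm v \<le> norm v"
            by (simp add: mult_left_le_one_le)
          then show ?thesis by (simp flip: scaleR_diff_left)
        qed
        then show "l2_norm \<rho> ?r \<le> norm v"
          using rL2 by (intro l2_norm_le_bound prob L2_measurable)
      qed (use near2 e l2_norm_nonneg in auto)
      finally have "\<bar>l2_inner \<rho> ?w ?r\<bar> \<le> e * norm v" .
      moreover have "l2_inner \<rho> ?w ?r = l2_inner \<rho> ?w (\<lambda>x. indicator S x *\<^sub>R v) - l2_inner \<rho> ?w ?p"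
        using SL2 pL2 w by (intro l2_inner_diff_right)
      ultimately have "\<bar>B (\<lambda>x. indicator S x *\<^sub>R v)\<bar> \<le> 2 * e * (1 + norm v) + e * norm v"
        using step Ap unfolding B_def by linarith
      also have "\<dots> = e * (2 + 3 * norm v)" by (simp add: algebra_simps)
      also have "\<dots> = \<eta>"
        using norm_ge_zero[of v] by (simp add: e_def add_nonneg_eq_0_iff)
      finally show ?thesis by simp
    qed
    then have "\<bar>B (\<lambda>x. indicator S x *\<^sub>R v)\<bar> \<le> 0" by (rule field_le_epsilon)
    then show "B (\<lambda>x. indicator S x *\<^sub>R v) = 0" by simp
  qed
  then show ?thesis by (simp add: B_def)
qed

subsection \<open>Maps from parameters into square integrable vector fields\<close>

text \<open>Clearing the denominator extends the estimate to \<open>\<eta> = \<theta>\<close>, where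
  the remainder is \<open>- D 0\<close>; this vanishes almost everywhere by linearity with zero
  coefficients.\<close>

lemma has_l2_derivative_eventually_remainder:
  assumes D: "has_l2_derivative \<rho> \<phi> D \<theta>" and e: "e > 0"
  shows "\<forall>\<^sub>F \<eta> in nhds \<theta>. \<phi> \<eta> \<in> L2 \<rho> \<and>
    l2_norm \<rho> (\<lambda>x. \<phi> \<eta> x - \<phi> \<theta> x - D (\<eta> - \<theta>) x) \<le> e * norm (\<eta> - \<theta>)"
proof -
  have 1: "\<forall>\<^sub>F \<eta> in nhds \<theta>. \<phi> \<eta> \<in> L2 \<rho>"
    and lim: "((\<lambda>\<eta>. l2_norm \<rho> (\<lambda>x. \<phi> \<eta> x - \<phi> \<theta> x - D (\<eta> - \<theta>) x) / norm (\<eta> - \<theta>)) \<longlongrightarrow> 0) (at \<theta>)"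
    and lin: "AE x in \<rho>. D (0 *\<^sub>R 0 + 0 *\<^sub>R 0) x = 0 *\<^sub>R D 0 x + 0 *\<^sub>R D 0 x"
    and L2: "D 0 \<in> L2 \<rho>"
    using D unfolding has_l2_derivative_def by blast+
  have "l2_norm \<rho> (\<lambda>x. D 0 x) = 0"
    using lin L2 by (subst l2_norm_eq_0_iff) auto
  then have zero: "l2_norm \<rho> (\<lambda>x. - D 0 x) = 0"
    by (simp add: l2_norm_minus)
  have "\<forall>\<^sub>F \<eta> in at \<theta>. l2_norm \<rho> (\<lambda>x. \<phi> \<eta> x - \<phi> \<theta> x - D (\<eta> - \<theta>) x) / norm (\<eta> - \<theta>) < e"
    using order_tendstoD(2)[OF lim e] .
  then have "\<forall>\<^sub>F \<eta> in nhds \<theta>. \<eta> \<noteq> \<theta> \<longrightarrow>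
      l2_norm \<rho> (\<lambda>x. \<phi> \<eta> x - \<phi> \<theta> x - D (\<eta> - \<theta>) x) / norm (\<eta> - \<theta>) < e"
    by (simp add: eventually_at_filter)
  with 1 show ?thesis
  proof eventually_elim
    case (elim \<eta>)
    show ?case
    proof (cases "\<eta> = \<theta>")
      case True
      then show ?thesis using elim zero by simp
    next
      case False
      then show ?thesis using elim by (simp add: pos_divide_less_eq)
    qed
  qed
qed

lemma has_l2_derivative_L2:
  assumes "has_l2_derivative \<rho> \<phi> D \<theta>"
  shows "D h \<in> L2 \<rho>" "\<phi> \<theta> \<in> L2 \<rho>"
  using assms eventually_nhds_x_imp_x unfolding has_l2_derivative_def by blast+

text \<open>Both expansions are compared at \<open>\<theta> + t *\<^sub>R h\<close> for a small
  \<open>t\<close>. Homogeneity turns the difference of the remainders into \<open>t\<close> times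
  the difference of the differentials, up to null sets, and \<open>t\<close> cancels.\<close>

lemma has_l2_derivative_unique:
  assumes D: "has_l2_derivative \<rho> \<phi> D \<theta>" and D': "has_l2_derivative \<rho> \<phi> D' \<theta>"
  shows "AE x in \<rho>. D h x = D' h x"
proof -
  note L2 = has_l2_derivative_L2[OF D] has_l2_derivative_L2[OF D']
  have scale: "AE x in \<rho>. E (t *\<^sub>R h) x = t *\<^sub>R E h x" if "has_l2_derivative \<rho> \<phi> E \<theta>" for E t
  proof -
    have "AE x in \<rho>. E (t *\<^sub>R h + 0 *\<^sub>R h) x = t *\<^sub>R E h x + 0 *\<^sub>R E h x"
      using that unfolding has_l2_derivative_def by blast
    then show ?thesis by simp
  qed
  let ?\<Delta> = "\<lambda>x. D h x - D' h x"
  have "l2_norm \<rho> ?\<Delta> \<le> 0 + e" if "e > 0" for e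
  proof -
    define e' where "e' = e / (2 * (1 + norm h))"
    have e': "e' > 0" using that by (simp add: e'_def add_pos_nonneg)
    have "\<forall>\<^sub>F \<eta> in nhds \<theta>. \<phi> \<eta> \<in> L2 \<rho> \<and>
      l2_norm \<rho> (\<lambda>x. \<phi> \<eta> x - \<phi> \<theta> x - D (\<eta> - \<theta>) x) \<le> e' * norm (\<eta> - \<theta>) \<and>
      l2_norm \<rho> (\<lambda>x. \<phi> \<eta> x - \<phi> \<theta> x - D' (\<eta> - \<theta>) x) \<le> e' * norm (\<eta> - \<theta>)"
      using has_l2_derivative_eventually_remainder[OF D e'] has_l2_derivative_eventually_remainder[OF D' e']
      by eventually_elim simp
    then obtain d where d: "d > 0" "\<And>\<eta>. dist \<eta> \<theta> < d \<Longrightarrow> \<phi> \<eta> \<in> L2 \<rho> \<and>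
      l2_norm \<rho> (\<lambda>x. \<phi> \<eta> x - \<phi> \<theta> x - D (\<eta> - \<theta>) x) \<le> e' * norm (\<eta> - \<theta>) \<and>
      l2_norm \<rho> (\<lambda>x. \<phi> \<eta> x - \<phi> \<theta> x - D' (\<eta> - \<theta>) x) \<le> e' * norm (\<eta> - \<theta>)"
      by (auto simp: eventually_nhds_metric)
    define t where "t = d / (2 * (1 + norm h))"
    have t: "t > 0" using d by (simp add: t_def add_pos_nonneg)
    have "2 * (t * (1 + norm h)) = d" by (simp add: t_def add_nonneg_eq_0_iff del: distrib_left_numeral)
    then have "t * norm h < d" using t d(1) unfolding distrib_left by linarith
    define \<eta> where "\<eta> = \<theta> + t *\<^sub>R h"
    have \<eta>: "\<eta> - \<theta> = t *\<^sub>R h" "dist \<eta> \<theta> < d" "norm (\<eta> - \<theta>) = t * norm h"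
      using \<open>t * norm h < d\<close> t by (simp_all add: \<eta>_def dist_norm)
    let ?r = "\<lambda>E x. \<phi> \<eta> x - \<phi> \<theta> x - E (t *\<^sub>R h) x"
    have r: "\<phi> \<eta> \<in> L2 \<rho>" "l2_norm \<rho> (?r D) \<le> e' * (t * norm h)" "l2_norm \<rho> (?r D') \<le> e' * (t * norm h)"
      using d(2)[OF \<eta>(2)] \<eta> by auto
    have rL2: "?r D \<in> L2 \<rho>" "?r D' \<in> L2 \<rho>"
      using r(1) L2 by (auto intro!: L2_diff)
    have "t * l2_norm \<rho> ?\<Delta> = l2_norm \<rho> (\<lambda>x. t *\<^sub>R ?\<Delta> x)"
      using t l2_norm_scaleR[of \<rho> t ?\<Delta>] by simp
    also have "\<dots> = l2_norm \<rho> (\<lambda>x. ?r D' x - ?r D x)"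
      using scale[OF D, of t] scale[OF D', of t] rL2 L2 r(1)
      by (intro l2_norm_cong_AE L2_diff L2_scaleR) (auto simp: scaleR_diff_right elim: eventually_elim2)
    also have "\<dots> \<le> l2_norm \<rho> (?r D') + l2_norm \<rho> (?r D)"
      using rL2 by (intro l2_norm_triangle_diff)
    also have "\<dots> \<le> t * (2 * e' * norm h)"
      using r(2,3) by (simp add: mult_ac)
    finally have "l2_norm \<rho> ?\<Delta> \<le> 2 * e' * norm h"
      using t by simp
    also have "\<dots> \<le> 2 * e' * (1 + norm h)"
      using e' by simp
    also have "\<dots> = e"
      by (simp add: e'_def add_nonneg_eq_0_iff del: distrib_left_numeral)
    finally show ?thesis by simp
  qed
  then have "l2_norm \<rho> ?\<Delta> \<le> 0" by (rule field_le_epsilon)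
  then have "l2_norm \<rho> ?\<Delta> = 0" using l2_norm_nonneg[of \<rho> ?\<Delta>] by simp
  then show ?thesis
    using L2 by (simp add: l2_norm_eq_0_iff L2_diff)
qed

lemma has_l2_derivative_diff_const:
  assumes "k \<in> L2 \<rho>"
  shows "has_l2_derivative \<rho> (\<lambda>\<eta> x. \<phi> \<eta> x - k x) D \<theta> \<longleftrightarrow> has_l2_derivative \<rho> \<phi> D \<theta>"
proof -
  have "(\<lambda>x. g x - k x) \<in> L2 \<rho> \<longleftrightarrow> g \<in> L2 \<rho>" for g
    using L2_diff[OF _ assms, of g] L2_add[OF _ assms, of "\<lambda>x. g x - k x"] by auto
  then show ?thesis
    by (simp add: has_l2_derivative_def)
qed

text \<open>The error splits into the remainder of \<open>\<Phi>\<close> at the increment of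
  \<open>\<phi>\<close> and the value of \<open>A\<close> on the remainder of \<open>\<phi>\<close>;
  each is made at most half of \<open>e * norm (\<eta> - \<theta>)\<close>.\<close>

lemma l2_chain_rule:
  assumes D: "has_l2_derivative \<rho> \<phi> D \<theta>"
    and bound: "\<And>h. l2_norm \<rho> (D h) \<le> K * norm h" and blin: "bounded_linear (\<lambda>h. A (D h))"
    and lin: "\<And>a b g h. g \<in> L2 \<rho> \<Longrightarrow> h \<in> L2 \<rho> \<Longrightarrow> A (\<lambda>x. a *\<^sub>R g x + b *\<^sub>R h x) = a * A g + b * A h"
    and bdd: "\<And>g. g \<in> L2 \<rho> \<Longrightarrow> \<bar>A g\<bar> \<le> C * l2_norm \<rho> g"
    and exp: "\<And>e. e > 0 \<Longrightarrow> \<exists>d>0. \<forall>g\<in>L2 \<rho>. l2_norm \<rho> g < d \<longrightarrow>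
      \<bar>\<Phi> (\<lambda>x. \<phi> \<theta> x + g x) - \<Phi> (\<phi> \<theta>) - A g\<bar> \<le> e * l2_norm \<rho> g"
  shows "((\<lambda>\<eta>. \<Phi> (\<phi> \<eta>)) has_derivative (\<lambda>h. A (D h))) (at \<theta>)"
  unfolding has_derivative_at_alt
proof (intro conjI allI impI blin)
  fix e :: real assume e: "e > 0"
  \<comment> \<open>A Lipschitz constant of \<open>\<phi>\<close> near \<open>\<theta>\<close>:
    \<open>\<bar>K\<bar>\<close> accounts for the differential and the added 1 for the remainder, as
    \<open>e2\<close> is at most 1.\<close>
  define K' where "K' = \<bar>K\<bar> + 1"
  define e1 where "e1 = e / (2 * K')"
  define e2 where "e2 = min 1 (e / (2 * (\<bar>C\<bar> + 1)))"
  have pos: "K' > 0" "e1 > 0" "e2 > 0"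
    using e by (auto simp: K'_def e1_def e2_def)
  obtain d1 where d1: "d1 > 0" "\<And>g. g \<in> L2 \<rho> \<Longrightarrow> l2_norm \<rho> g < d1 \<Longrightarrow>
    \<bar>\<Phi> (\<lambda>x. \<phi> \<theta> x + g x) - \<Phi> (\<phi> \<theta>) - A g\<bar> \<le> e1 * l2_norm \<rho> g"
    using exp[OF pos(2)] by blast
  obtain d2 where d2: "d2 > 0" "\<And>\<eta>. dist \<eta> \<theta> < d2 \<Longrightarrow> \<phi> \<eta> \<in> L2 \<rho> \<and>
    l2_norm \<rho> (\<lambda>x. \<phi> \<eta> x - \<phi> \<theta> x - D (\<eta> - \<theta>) x) \<le> e2 * norm (\<eta> - \<theta>)"
    using has_l2_derivative_eventually_remainder[OF D pos(3)] by (auto simp: eventually_nhds_metric)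
  show "\<exists>d>0. \<forall>\<eta>. norm (\<eta> - \<theta>) < d \<longrightarrow>
    norm (\<Phi> (\<phi> \<eta>) - \<Phi> (\<phi> \<theta>) - A (D (\<eta> - \<theta>))) \<le> e * norm (\<eta> - \<theta>)"
  proof (intro exI[of _ "min d2 (d1 / K')"] conjI allI impI)
    show "0 < min d2 (d1 / K')" using d1(1) d2(1) pos by simp
    fix \<eta> assume "norm (\<eta> - \<theta>) < min d2 (d1 / K')"
    then have n: "norm (\<eta> - \<theta>) < d2" "K' * norm (\<eta> - \<theta>) < d1"
      using pos by (auto simp: pos_less_divide_eq mult.commute)
    let ?g = "\<lambda>x. \<phi> \<eta> x - \<phi> \<theta> x"
    let ?D = "D (\<eta> - \<theta>)"
    let ?r = "\<lambda>x. ?g x - ?D x"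
    have \<eta>: "\<phi> \<eta> \<in> L2 \<rho>" "l2_norm \<rho> ?r \<le> e2 * norm (\<eta> - \<theta>)"
      using d2(2)[of \<eta>] n by (auto simp: dist_norm)
    have L2: "?g \<in> L2 \<rho>" "?D \<in> L2 \<rho>" "?r \<in> L2 \<rho>"
      using \<eta>(1) has_l2_derivative_L2[OF D] by (auto intro!: L2_diff)
    have "e2 * norm (\<eta> - \<theta>) \<le> 1 * norm (\<eta> - \<theta>)" "K * norm (\<eta> - \<theta>) \<le> \<bar>K\<bar> * norm (\<eta> - \<theta>)"
      by (intro mult_right_mono; simp add: e2_def)+
    moreover have "l2_norm \<rho> ?g \<le> l2_norm \<rho> ?r + l2_norm \<rho> ?D"
      using l2_norm_triangle[OF L2(3,2)] by simp
    ultimately have g: "l2_norm \<rho> ?g \<le> K' * norm (\<eta> - \<theta>)"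
      using \<eta>(2) bound[of "\<eta> - \<theta>"] by (simp add: K'_def distrib_right)
    have "\<bar>\<Phi> (\<phi> \<eta>) - \<Phi> (\<phi> \<theta>) - A ?g\<bar> \<le> e1 * l2_norm \<rho> ?g"
      using d1(2)[OF L2(1)] g n by simp
    also have "\<dots> \<le> e1 * (K' * norm (\<eta> - \<theta>))"
      using g pos by (intro mult_left_mono) auto
    also have "\<dots> = e * norm (\<eta> - \<theta>) / 2"
      using pos by (simp add: e1_def)
    finally have 1: "\<bar>\<Phi> (\<phi> \<eta>) - \<Phi> (\<phi> \<theta>) - A ?g\<bar> \<le> e * norm (\<eta> - \<theta>) / 2" .
    have "\<bar>A ?g - A ?D\<bar> = \<bar>A ?r\<bar>"
      using lin[OF L2(1,2), of 1 "-1"] by simp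
    also have "\<dots> \<le> C * l2_norm \<rho> ?r"
      using L2(3) by (rule bdd)
    also have "\<dots> \<le> (\<bar>C\<bar> + 1) * (e / (2 * (\<bar>C\<bar> + 1)) * norm (\<eta> - \<theta>))"
    proof (rule mult_mono)
      have "e2 * norm (\<eta> - \<theta>) \<le> e / (2 * (\<bar>C\<bar> + 1)) * norm (\<eta> - \<theta>)"
        by (intro mult_right_mono) (auto simp: e2_def)
      then show "l2_norm \<rho> ?r \<le> e / (2 * (\<bar>C\<bar> + 1)) * norm (\<eta> - \<theta>)"
        using \<eta>(2) by linarith
    qed (auto simp: l2_norm_nonneg)
    also have "\<dots> = e * norm (\<eta> - \<theta>) / 2"
      by (simp add: add_nonneg_eq_0_iff del: distrib_left_numeral)
    finally show "norm (\<Phi> (\<phi> \<eta>) - \<Phi> (\<phi> \<theta>) - A ?D) \<le> e * norm (\<eta> - \<theta>)"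
      using 1 unfolding real_norm_def by linarith
  qed
qed

section \<open>The Gram matrix, normal equations and least squares\<close>

text \<open>Identifies the Gram matrix with the pullback metric. The integral is matrix-valued, so
  integrability of the field is established first; the bounded linear map sending \<open>G\<close>
  to \<open>(G *v h) \<bullet> k\<close> then passes under the integral.\<close>

lemma gram_matrix_mult:
  fixes J :: "real^'d \<Rightarrow> real^'m^'d"
  assumes J: "\<And>h. (\<lambda>x. J x *v h) \<in> L2 \<rho>"
  shows "((LINT x|\<rho>. transpose (J x) ** J x) *v h) \<bullet> k = l2_inner \<rho> (\<lambda>x. J x *v h) (\<lambda>x. J x *v k)"
proof -
  let ?T = "\<lambda>x. transpose (J x) ** J x"
  have comp: "?T x $ i $ j = (J x *v axis i 1) \<bullet> (J x *v axis j 1)" for x i j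
    by (simp add: matrix_vector_mult_basis matrix_matrix_mult_def transpose_def inner_vec_def column_def)
  \<comment> \<open>Expansion in matrix units, which reduces integrability of the matrix field to
    that of its entries, the inner products of the columns of \<open>J x\<close>.\<close>
  have sum: "(\<Sum>i\<in>UNIV. \<Sum>j\<in>UNIV. T $ i $ j *\<^sub>R axis i (axis j 1)) = T" for T :: "real^'m^'m"
  proof -
    have "(\<Sum>j\<in>UNIV. T $ i $ j *\<^sub>R axis i (axis j (1::real))) = axis i (T $ i)" for i
    proof -
      have "(\<Sum>j\<in>UNIV. T $ i $ j *\<^sub>R axis i (axis j (1::real))) $ a = axis i (\<Sum>j\<in>UNIV. T $ i $ j *\<^sub>R axis j 1) $ a" for a
        by (cases "a = i") (simp_all add: axis_def)
      then have "(\<Sum>j\<in>UNIV. T $ i $ j *\<^sub>R axis i (axis j (1::real))) = axis i (\<Sum>j\<in>UNIV. T $ i $ j *\<^sub>R axis j 1)"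
        by (subst vec_eq_iff) blast
      also have "(\<Sum>j\<in>UNIV. T $ i $ j *\<^sub>R axis j 1) = T $ i"
        using basis_expansion[of "T $ i"] by (simp add: scalar_mult_eq_scaleR)
      finally show ?thesis .
    qed
    then show ?thesis
      by (simp add: vec_eq_iff[of _ T]) (simp add: axis_def)
  qed
  have "integrable \<rho> (\<lambda>x. \<Sum>i\<in>UNIV. \<Sum>j\<in>UNIV. ?T x $ i $ j *\<^sub>R axis i (axis j (1::real)))"
    unfolding comp by (intro Bochner_Integration.integrable_sum integrable_scaleR_left L2_integrable_inner J)
  then have int: "integrable \<rho> ?T"
    by (simp only: sum)
  have "bounded_linear (\<lambda>G :: real^'m^'m. (G *v h) \<bullet> k)"
  proof -
    have "linear (\<lambda>G :: real^'m^'m. (G *v h) \<bullet> k)"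
      by (auto intro!: linearI simp: matrix_vector_mult_add_rdistrib inner_add_left
        scaleR_matrix_vector_assoc[symmetric])
    then show ?thesis by (simp add: linear_conv_bounded_linear)
  qed
  from integral_bounded_linear[OF this int]
  have "((LINT x|\<rho>. ?T x) *v h) \<bullet> k = (LINT x|\<rho>. (?T x *v h) \<bullet> k)" by simp
  also have "\<dots> = (LINT x|\<rho>. (J x *v h) \<bullet> (J x *v k))"
    by (intro Bochner_Integration.integral_cong refl)
      (simp add: dot_lmul_matrix[symmetric] matrix_vector_mul_assoc[symmetric] inner_commute
        transpose_matrix_vector)
  finally show ?thesis by (simp add: l2_inner_def)
qed

text \<open>By Cauchy-Schwarz, a direction of zero norm is orthogonal to all others in the pullback
  metric, so the Gram matrix sends it to 0.\<close>

lemma gram_matrix_invertible_injective: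
  fixes J :: "real^'d \<Rightarrow> real^'m^'d"
  assumes J: "\<And>h. (\<lambda>x. J x *v h) \<in> L2 \<rho>"
    and inv: "invertible (LINT x|\<rho>. transpose (J x) ** J x)"
    and zero: "l2_norm \<rho> (\<lambda>x. J x *v u) = 0"
  shows "u = 0"
proof -
  let ?G = "LINT x|\<rho>. transpose (J x) ** J x"
  have "(?G *v u) \<bullet> k = 0" for k
    using l2_cauchy_schwarz[OF J J, of u k] zero by (simp add: gram_matrix_mult[OF J])
  then have "?G *v u = 0"
    by (metis inner_eq_zero_iff)
  obtain G' where "G' ** ?G = mat 1"
    using inv unfolding invertible_def by blast
  then have "u = G' *v (?G *v u)"
    by (simp add: matrix_vector_mul_assoc)
  then show ?thesis
    using \<open>?G *v u = 0\<close> by simp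
qed

text \<open>The squared norm is the quadratic form of the Gram matrix, so the square root of its
  operator norm serves as \<open>K\<close>. This is the bound that the chain rule asks for.\<close>

lemma l2_norm_matrix_bounded:
  fixes J :: "real^'d \<Rightarrow> real^'m^'d"
  assumes J: "\<And>h. (\<lambda>x. J x *v h) \<in> L2 \<rho>"
  shows "\<exists>K. \<forall>h. l2_norm \<rho> (\<lambda>x. J x *v h) \<le> K * norm h"
proof (intro exI allI)
  fix h :: "real^'m"
  let ?G = "LINT x|\<rho>. transpose (J x) ** J x"
  let ?K = "onorm ((*v) ?G)"
  have bl: "bounded_linear ((*v) ?G)"
    by (rule matrix_vector_mul_bounded_linear)
  have "(l2_norm \<rho> (\<lambda>x. J x *v h))\<^sup>2 = (?G *v h) \<bullet> h"
    by (simp add: l2_norm_power2 gram_matrix_mult[OF J])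
  also have "\<dots> \<le> norm (?G *v h) * norm h"
    by (rule norm_cauchy_schwarz)
  also have "\<dots> \<le> ?K * norm h * norm h"
    using onorm[OF bl, of h] by (intro mult_right_mono) auto
  also have "\<dots> = (sqrt ?K * norm h)\<^sup>2"
    using onorm_pos_le[OF bl] by (simp add: power_mult_distrib power2_eq_square)
  finally show "l2_norm \<rho> (\<lambda>x. J x *v h) \<le> sqrt ?K * norm h"
    by (rule power2_le_imp_le) (simp add: onorm_pos_le[OF bl])
qed

text \<open>Assumption \<open>v\<close> is the normal equation: \<open>w\<close> minus
  \<open>J x *v v\<close> is orthogonal to the range of the differential. By Pythagoras the
  objective exceeds its value at \<open>- v\<close> by the squared norm of
  \<open>J x *v (\<delta> + v)\<close>, which is zero only for \<open>\<delta> = - v\<close> by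
  invertibility.\<close>

lemma least_squares_arg_min_iff:
  fixes J :: "real^'d \<Rightarrow> real^'m^'d"
  assumes J: "\<And>h. (\<lambda>x. J x *v h) \<in> L2 \<rho>"
    and inv: "invertible (LINT x|\<rho>. transpose (J x) ** J x)"
    and w: "w \<in> L2 \<rho>"
    and v: "\<And>h. ((LINT x|\<rho>. transpose (J x) ** J x) *v v) \<bullet> h = l2_inner \<rho> w (\<lambda>x. J x *v h)"
  shows "is_arg_min (\<lambda>\<delta>. (l2_norm \<rho> (\<lambda>x. w x + J x *v \<delta>))\<^sup>2) (\<lambda>_. True) \<delta> \<longleftrightarrow> \<delta> = - v"
proof -
  let ?q = "\<lambda>\<delta>. (l2_norm \<rho> (\<lambda>x. w x + J x *v \<delta>))\<^sup>2"
  have q: "?q \<delta> = ?q (- v) + (l2_norm \<rho> (\<lambda>x. J x *v (\<delta> + v)))\<^sup>2" for \<delta>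
  proof -
    let ?r = "\<lambda>x. w x - J x *v v" and ?u = "\<lambda>x. J x *v (\<delta> + v)"
    have r: "?r \<in> L2 \<rho>" using w J by (rule L2_diff)
    have orth: "l2_inner \<rho> ?r ?u = 0"
      using v[of "\<delta> + v"] w J by (simp add: l2_inner_diff_left gram_matrix_mult[OF J])
    have "(\<lambda>x. w x + J x *v \<delta>) = (\<lambda>x. ?r x + ?u x)"
      by (simp add: matrix_vector_right_distrib)
    then have "?q \<delta> = l2_inner \<rho> (\<lambda>x. ?r x + ?u x) (\<lambda>x. ?r x + ?u x)"
      by (simp add: l2_norm_power2)
    also have "\<dots> = l2_inner \<rho> ?r ?r + l2_inner \<rho> ?u ?u"
      using r J[of "\<delta> + v"] orth l2_inner_commute[of \<rho> ?r ?u]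
      by (simp only: l2_inner_add_left l2_inner_add_right L2_add)
    also have "\<dots> = ?q (- v) + (l2_norm \<rho> ?u)\<^sup>2"
      by (simp add: l2_norm_power2 vec.neg)
    finally show ?thesis .
  qed
  show ?thesis
  proof
    assume "is_arg_min ?q (\<lambda>_. True) \<delta>"
    then have "?q \<delta> \<le> ?q (- v)"
      by (auto simp: is_arg_min_def not_less)
    then have "l2_norm \<rho> (\<lambda>x. J x *v (\<delta> + v)) = 0"
      using q[of \<delta>] by simp
    then have "\<delta> + v = 0"
      by (rule gram_matrix_invertible_injective[OF J inv])
    then show "\<delta> = - v" by (simp add: eq_neg_iff_add_eq_0)
  next
    assume "\<delta> = - v"
    moreover have "?q (- v) \<le> ?q \<delta>'" for \<delta>'
      unfolding q[of \<delta>'] by simp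
    ultimately show "is_arg_min ?q (\<lambda>_. True) \<delta>"
      by (simp add: is_arg_min_def flip: not_le)
  qed
qed

text \<open>The definition ranges over all differentials of \<open>l\<close>. They agree up to null
  sets, so all of them give the same objective, and one representative suffices.\<close>

lemma gauss_newton_update_eq:
  assumes D: "has_l2_derivative \<rho> l D \<theta>"
  shows "gauss_newton_update \<rho> l \<tau> \<theta> =
    {\<theta> + \<tau> *\<^sub>R \<delta> | \<delta>. is_arg_min (\<lambda>\<delta>. (l2_norm \<rho> (\<lambda>x. l \<theta> x + D \<delta> x))\<^sup>2) (\<lambda>_. True) \<delta>}"
proof -
  have eq: "(\<lambda>\<delta>. (l2_norm \<rho> (\<lambda>x. l \<theta> x + D' \<delta> x))\<^sup>2) = (\<lambda>\<delta>. (l2_norm \<rho> (\<lambda>x. l \<theta> x + D \<delta> x))\<^sup>2)"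
    if "has_l2_derivative \<rho> l D' \<theta>" for D'
  proof
    fix \<delta>
    have "l2_norm \<rho> (\<lambda>x. l \<theta> x + D' \<delta> x) = l2_norm \<rho> (\<lambda>x. l \<theta> x + D \<delta> x)"
      using has_l2_derivative_L2[OF D] has_l2_derivative_L2[OF that] has_l2_derivative_unique[OF that D]
      by (intro l2_norm_cong_AE L2_add) auto
    then show "(l2_norm \<rho> (\<lambda>x. l \<theta> x + D' \<delta> x))\<^sup>2 = (l2_norm \<rho> (\<lambda>x. l \<theta> x + D \<delta> x))\<^sup>2"
      by simp
  qed
  have "has_l2_derivative \<rho> l D' \<theta> \<and>
      is_arg_min (\<lambda>\<delta>. (l2_norm \<rho> (\<lambda>x. l \<theta> x + D' \<delta> x))\<^sup>2) (\<lambda>_. True) \<delta> \<longleftrightarrow>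
      has_l2_derivative \<rho> l D' \<theta> \<and>
      is_arg_min (\<lambda>\<delta>. (l2_norm \<rho> (\<lambda>x. l \<theta> x + D \<delta> x))\<^sup>2) (\<lambda>_. True) \<delta>" for D' \<delta>
    by (rule conj_cong[OF refl]) (simp only: eq)
  then show ?thesis
    unfolding gauss_newton_update_def using D by auto
qed

section \<open>Equality of the Gauss-Newton and natural gradient updates\<close>

text \<open>Injectivity of the differential is part of the conclusion because the notion of natural
  gradient descent presupposes it. The singleton claims ensure that the equivalence of the schemes
  is not one between empty update sets.\<close>

theorem proposition2p4:
  fixes \<rho>\<^sub>0 :: "(real^'d) measure"
    and \<Theta> :: "(real^'m) set"
    and f :: "real^'m \<Rightarrow> real^'d \<Rightarrow> real^'d"
    and J :: "real^'m \<Rightarrow> real^'d \<Rightarrow> real^'m^'d"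
    and F :: "(real^'d) measure \<Rightarrow> real"
    and gradF :: "(real^'d) measure \<Rightarrow> real^'d \<Rightarrow> real^'d"
    and V :: "real^'m \<Rightarrow> real^'d \<Rightarrow> real^'d"
    and \<tau> :: real
  assumes "\<rho>\<^sub>0 \<in> P2" and "absolutely_continuous lborel \<rho>\<^sub>0"
    and "\<And>\<theta>. \<theta> \<in> \<Theta> \<Longrightarrow> has_l2_derivative \<rho>\<^sub>0 f (\<lambda>h x. J \<theta> x *v h) \<theta>"
    and "\<And>\<theta>. \<theta> \<in> \<Theta> \<Longrightarrow> invertible (LINT x|\<rho>\<^sub>0. transpose (J \<theta> x) ** J \<theta> x)"
    and "\<And>\<rho>. \<rho> \<in> P2 \<Longrightarrow> has_wasserstein_gradient F (gradF \<rho>) \<rho>"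
    and "\<And>g. g \<in> L2 \<rho>\<^sub>0 \<Longrightarrow> l2_functional_differentiable \<rho>\<^sub>0 (\<lambda>g. F (pushforward g \<rho>\<^sub>0)) g"
    and "\<And>\<theta>. \<theta> \<in> \<Theta> \<Longrightarrow> V \<theta> = (\<lambda>y. - gradF (pushforward (f \<theta>) \<rho>\<^sub>0) y)"
    and "\<tau> > 0"
  shows "(\<forall>\<theta>\<in>\<Theta>. l2_injective \<rho>\<^sub>0 (\<lambda>h x. J \<theta> x *v h)) \<and>
    (\<forall>\<theta>\<in>\<Theta>. \<exists>\<theta>'.
       drift_gauss_newton_update \<rho>\<^sub>0 f V \<tau> \<theta> = {\<theta>'} \<and>
       {\<theta> + \<tau> *\<^sub>R \<delta> | \<delta>. is_arg_min
          (\<lambda>\<delta>. (l2_norm \<rho>\<^sub>0 (\<lambda>x. - V \<theta> (f \<theta> x) + J \<theta> x *v \<delta>))\<^sup>2) (\<lambda>_. True) \<delta>} = {\<theta>'} \<and>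
       l2_natural_gradient_update \<rho>\<^sub>0 f (\<lambda>\<theta> h x. J \<theta> x *v h) F \<tau> \<theta> = {\<theta>'}) \<and>
    (\<forall>\<theta>. is_scheme \<Theta> (drift_gauss_newton_update \<rho>\<^sub>0 f V \<tau>) \<theta> \<longleftrightarrow>
          is_scheme \<Theta> (l2_natural_gradient_update \<rho>\<^sub>0 f (\<lambda>\<theta> h x. J \<theta> x *v h) F \<tau>) \<theta>)"
proof -
  have sets: "sets \<rho>\<^sub>0 = sets borel" and prob: "prob_space \<rho>\<^sub>0"
    using assms(1) by (auto simp: P2_def)
  have space: "space \<rho>\<^sub>0 = UNIV"
    using sets_eq_imp_space_eq[OF sets] by simp
  interpret prob_space \<rho>\<^sub>0 by fact
  note nonatomic = absolutely_continuous_subset_measure[OF finite_measure_axioms sets assms(2)]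
  have J: "(\<lambda>x. J \<theta> x *v h) \<in> L2 \<rho>\<^sub>0" and f: "f \<theta> \<in> L2 \<rho>\<^sub>0" if "\<theta> \<in> \<Theta>" for \<theta> h
    using has_l2_derivative_L2[OF assms(3)[OF that]] by auto
  have inj: "l2_injective \<rho>\<^sub>0 (\<lambda>h x. J \<theta> x *v h)" if \<theta>: "\<theta> \<in> \<Theta>" for \<theta>
    unfolding l2_injective_def
  proof (intro allI impI)
    fix h k assume "AE x in \<rho>\<^sub>0. J \<theta> x *v h = J \<theta> x *v k"
    then have "l2_norm \<rho>\<^sub>0 (\<lambda>x. J \<theta> x *v (h - k)) = 0"
      using J[OF \<theta>] by (subst l2_norm_eq_0_iff) (auto simp: matrix_vector_mult_diff_distrib intro: L2_diff)
    then have "h - k = 0"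
      by (rule gram_matrix_invertible_injective[OF J[OF \<theta>] assms(4)[OF \<theta>]])
    then show "h = k" by simp
  qed
  have step: "\<exists>\<theta>'. drift_gauss_newton_update \<rho>\<^sub>0 f V \<tau> \<theta> = {\<theta>'} \<and>
       {\<theta> + \<tau> *\<^sub>R \<delta> | \<delta>. is_arg_min
          (\<lambda>\<delta>. (l2_norm \<rho>\<^sub>0 (\<lambda>x. - V \<theta> (f \<theta> x) + J \<theta> x *v \<delta>))\<^sup>2) (\<lambda>_. True) \<delta>} = {\<theta>'} \<and>
       l2_natural_gradient_update \<rho>\<^sub>0 f (\<lambda>\<theta> h x. J \<theta> x *v h) F \<tau> \<theta> = {\<theta>'}" if \<theta>: "\<theta> \<in> \<Theta>" for \<theta>
  proof -
    let ?P = "pushforward (f \<theta>) \<rho>\<^sub>0"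
    let ?G = "LINT x|\<rho>\<^sub>0. transpose (J \<theta> x) ** J \<theta> x"
    note gram = gram_matrix_mult[OF J[OF \<theta>]]
    define w where "w x = gradF ?P (f \<theta> x)" for x
    have fm: "f \<theta> \<in> borel_measurable \<rho>\<^sub>0"
      using f[OF \<theta>] by (rule L2_measurable)
    have "?P \<in> P2"
      using f[OF \<theta>] fm by (simp add: P2_def prob_space_distr L2_def integrable_distr_eq)
    then have grad: "has_wasserstein_gradient F (gradF ?P) ?P"
      by (rule assms(5))
    then have w: "w \<in> L2 \<rho>\<^sub>0"
      using fm by (simp add: has_wasserstein_gradient_def L2_distr w_def[abs_def])
    obtain A C where A0:
      "\<forall>a b. \<forall>g\<in>L2 \<rho>\<^sub>0. \<forall>h\<in>L2 \<rho>\<^sub>0. A (\<lambda>x. a *\<^sub>R g x + b *\<^sub>R h x) = a * A g + b * A h"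
      "\<forall>g\<in>L2 \<rho>\<^sub>0. \<bar>A g\<bar> \<le> C * l2_norm \<rho>\<^sub>0 g"
      "\<forall>e>0. \<exists>d>0. \<forall>g\<in>L2 \<rho>\<^sub>0. l2_norm \<rho>\<^sub>0 g < d \<longrightarrow>
        \<bar>F (pushforward (\<lambda>x. f \<theta> x + g x) \<rho>\<^sub>0) - F ?P - A g\<bar> \<le> e * l2_norm \<rho>\<^sub>0 g"
      using assms(6)[OF f[OF \<theta>]] unfolding l2_functional_differentiable_def
      by (elim exE conjE) (rule that; assumption)
    note A = A0(1)[rule_format] A0(2)[rule_format] A0(3)[THEN spec, THEN mp]
    \<comment> \<open>Needed for every direction in \<open>L2\<close>: the directions
      \<open>J \<theta> x *v h\<close> used below need not be functions of
      \<open>f \<theta> x\<close>.\<close>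
    have Aw: "A g = l2_inner \<rho>\<^sub>0 w g" if g: "g \<in> L2 \<rho>\<^sub>0" for g
    proof -
      have "A g = l2_inner \<rho>\<^sub>0 (\<lambda>x. gradF ?P (f \<theta> x)) g"
        by (rule law_invariant_derivative[where A = A and f = "f \<theta>" and F = F and C = C,
          OF prob space _ f[OF \<theta>] _ _ _ grad g]) (fact nonatomic A)+
      then show ?thesis by (simp only: w_def[abs_def])
    qed
    have lin: "linear (\<lambda>h. A (\<lambda>x. J \<theta> x *v h))"
    proof (rule linearI)
      fix h k :: "real^'m" and a :: real
      show "A (\<lambda>x. J \<theta> x *v (h + k)) = A (\<lambda>x. J \<theta> x *v h) + A (\<lambda>x. J \<theta> x *v k)"
        using A(1)[OF J[OF \<theta>, of h] J[OF \<theta>, of k], of 1 1] by (simp add: matrix_vector_right_distrib)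
      show "A (\<lambda>x. J \<theta> x *v (a *\<^sub>R h)) = a *\<^sub>R A (\<lambda>x. J \<theta> x *v h)"
        using A(1)[OF J[OF \<theta>, of h] J[OF \<theta>, of h], of a 0] by (simp add: matrix_vector_mult_scaleR)
    qed
    \<comment> \<open>The adjoint of a linear functional, evaluated at 1, is the vector that
      represents it.\<close>
    define b where "b = adjoint (\<lambda>h. A (\<lambda>x. J \<theta> x *v h)) 1"
    have b: "b \<bullet> h = A (\<lambda>x. J \<theta> x *v h)" for h
      using adjoint_works[OF lin, of h 1] by (simp add: b_def inner_commute)
    obtain K where "\<And>h. l2_norm \<rho>\<^sub>0 (\<lambda>x. J \<theta> x *v h) \<le> K * norm h"
      using l2_norm_matrix_bounded[OF J[OF \<theta>]] by blast
    then have "((\<lambda>\<eta>. F (pushforward (f \<eta>) \<rho>\<^sub>0)) has_derivative (\<lambda>h. A (\<lambda>x. J \<theta> x *v h))) (at \<theta>)"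
      using lin by (intro l2_chain_rule[OF assms(3)[OF \<theta>] _ _ A]) (simp_all add: linear_conv_bounded_linear)
    then have deriv: "((\<lambda>\<eta>. F (pushforward (f \<eta>) \<rho>\<^sub>0)) has_derivative (\<lambda>h. b \<bullet> h)) (at \<theta>)"
      by (simp add: b)
    obtain G' where G': "?G ** G' = mat 1" "G' ** ?G = mat 1"
      using assms(4)[OF \<theta>] unfolding invertible_def by blast
    define v where "v = G' *v b"
    have Gv: "?G *v u = b \<longleftrightarrow> u = v" for u
      using G' by (auto simp: v_def matrix_vector_mul_assoc)
    have gradient: "has_riemannian_gradient (l2_pullback_metric \<rho>\<^sub>0 (\<lambda>\<theta> h x. J \<theta> x *v h))
        (\<lambda>\<theta>. F (pushforward (f \<theta>) \<rho>\<^sub>0)) u \<theta> \<longleftrightarrow> u = v" for u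
    proof -
      \<comment> \<open>Uniqueness of the derivative turns the defining equation of the Riemannian
        gradient into the linear system \<open>?G *v u = b\<close>.\<close>
      have "((\<lambda>\<eta>. F (pushforward (f \<eta>) \<rho>\<^sub>0)) has_derivative (\<lambda>h. (?G *v u) \<bullet> h)) (at \<theta>) \<longleftrightarrow> ?G *v u = b"
      proof
        assume "((\<lambda>\<eta>. F (pushforward (f \<eta>) \<rho>\<^sub>0)) has_derivative (\<lambda>h. (?G *v u) \<bullet> h)) (at \<theta>)"
        from has_derivative_unique[OF this deriv] show "?G *v u = b"
          by (simp only: fun_eq_iff vector_eq_rdot)
      qed (simp only: deriv)
      then show ?thesis
        by (simp add: has_riemannian_gradient_def l2_pullback_metric_def gram Gv)
    qed
    have natural: "l2_natural_gradient_update \<rho>\<^sub>0 f (\<lambda>\<theta> h x. J \<theta> x *v h) F \<tau> \<theta> = {\<theta> - \<tau> *\<^sub>R v}"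
      by (simp add: l2_natural_gradient_update_def riemannian_gradient_update_def gradient)
    \<comment> \<open>By \<open>b\<close> and \<open>Aw\<close>, the system
      \<open>?G *v v = b\<close> is the normal equation of this least-squares problem.\<close>
    have "is_arg_min (\<lambda>\<delta>. (l2_norm \<rho>\<^sub>0 (\<lambda>x. w x + J \<theta> x *v \<delta>))\<^sup>2) (\<lambda>_. True) \<delta> \<longleftrightarrow> \<delta> = - v" for \<delta>
      using Gv[of v] by (intro least_squares_arg_min_iff J \<theta> assms(4) w) (simp add: b Aw J \<theta>)
    then have argmin: "{\<theta> + \<tau> *\<^sub>R \<delta> | \<delta>. is_arg_min
        (\<lambda>\<delta>. (l2_norm \<rho>\<^sub>0 (\<lambda>x. w x + J \<theta> x *v \<delta>))\<^sup>2) (\<lambda>_. True) \<delta>} = {\<theta> - \<tau> *\<^sub>R v}"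
      by simp
    have V: "V \<theta> (f \<theta> x) = - w x" for x
      by (simp add: assms(7)[OF \<theta>] w_def)
    \<comment> \<open>With the stop-gradient frozen, the residual is \<open>f\<close> minus a fixed
      element of \<open>L2\<close>: its value at the current parameter is \<open>w\<close>, and its
      differential is that of \<open>f\<close>.\<close>
    have res: "drift_residual f V \<theta> = (\<lambda>\<eta> x. f \<eta> x - (f \<theta> x - w x))"
      by (simp add: drift_residual_def V fun_eq_iff)
    have "has_l2_derivative \<rho>\<^sub>0 (drift_residual f V \<theta>) (\<lambda>h x. J \<theta> x *v h) \<theta>"
      unfolding res using assms(3)[OF \<theta>] by (simp only: has_l2_derivative_diff_const[OF L2_diff[OF f[OF \<theta>] w]])
    from gauss_newton_update_eq[OF this]
    have "drift_gauss_newton_update \<rho>\<^sub>0 f V \<tau> \<theta> = {\<theta> - \<tau> *\<^sub>R v}"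
      by (simp add: drift_gauss_newton_update_def res argmin)
    then show ?thesis
      using natural argmin by (simp add: V)
  qed
  \<comment> \<open>Agreement on \<open>\<Theta>\<close> is enough, since the iterates of a scheme
    stay in \<open>\<Theta>\<close>.\<close>
  have "drift_gauss_newton_update \<rho>\<^sub>0 f V \<tau> \<theta> =
      l2_natural_gradient_update \<rho>\<^sub>0 f (\<lambda>\<theta> h x. J \<theta> x *v h) F \<tau> \<theta>" if "\<theta> \<in> \<Theta>" for \<theta>
    using step[OF that] by auto
  then have "is_scheme \<Theta> (drift_gauss_newton_update \<rho>\<^sub>0 f V \<tau>) \<theta> \<longleftrightarrow>
      is_scheme \<Theta> (l2_natural_gradient_update \<rho>\<^sub>0 f (\<lambda>\<theta> h x. J \<theta> x *v h) F \<tau>) \<theta>" for \<theta>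
    unfolding is_scheme_def by metis
  with inj step show ?thesis by blast
qed

end
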